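(* For $\varepsilon>0$ and $f\in\Omega$ let $X_\varepsilon(f)$ be the Haar measure of the $\varepsilon$-neighbourhood $\{x\in K^d:\inf_{y\in N(f)}\|x-y\|_\infty\le\varepsilon\}$ of the random Kakeya set $N(f)\subset R^d$. Then the expected value $\mathbb E[X_\varepsilon]$ is equivalent to $$\frac{2\,(q^d-1)}{(q-1)(q^{d-1}-1)}\cdot\frac{1}{|\log_q\varepsilon|}$$ when $\varepsilon\to 0$ (i.e. the ratio of the two quantities tends to $1$).
   Context: $K$ is a field complete with respect to a discrete valuation $\mathrm{val}$ normalized by $\mathrm{val}(\pi)=1$ for a uniformizer $\pi$; $R$ is its ring of integers, $\mathfrak m=\pi R$ its maximal ideal, and the residue field $k=R/\mathfrak m$ is finite with $q$ elements. The norm is $|x|=q^{-\mathrm{val}(x)}$, and $d\ge 2$ is an integer. $K^d$ is equipped with $\|(x_1,\dots,x_d)\|_\infty=\max_i|x_i|$ and with the Haar measure $\mu$ normalized by $\mu(R^d)=1$. $\mathbb S^{d-1}(K)=\{x\in K^d:\|x\|_\infty=1\}$. $\mathbb P^{d-1}(K)$ is the set of lines through $0$ in $K^d$, identified with $\mathbb S^{d-1}(K)/R^\times$, with the distance $\mathrm{dist}(a,b)=\inf\|\hat a-\hat b\|_\infty$, the infimum being over all representatives $\hat a,\hat b\in\mathbb S^{d-1}(K)$ of $a$ and $b$. For $a\in\mathbb P^{d-1}(K)$, $\mathrm{can}(a)=(a_1,\dots,a_d)\in\mathbb S^{d-1}(K)$ is the unique representative of $a$ for which there is an index $j$ with $a_j=1$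 and $|a_i|<1$ for all $i<j$. $\Omega$ is the set of $1$-Lipschitz functions $\mathbb P^{d-1}(K)\to R^d$. It is a group under pointwise addition, compact for the topology of uniform convergence, and is equipped with its Haar probability measure, with respect to which the expectation $\mathbb E$ is taken. For $f\in\Omega$ the associated (random) Kakeya set is $$N(f)=\bigcup_{a\in\mathbb P^{d-1}(K)}\{t\cdot\mathrm{can}(a)+f(a): t\in R\}\subset R^d.$$ *)

theory Defs
  imports
    "HOL-Analysis.Analysis"
    "HOL-Probability.Probability_Measure"
    "HOL-Library.Landau_Symbols"
begin

section \<open>Complete discretely valued fields with finite residue field\<close>

text \<open>
  A discrete valuation is a map \<open>val :: 'a \<Rightarrow> int\<close> that is only meaningful on nonzero elements:
  \<open>val 0\<close> is unconstrained and stands for infinity, so every definition treats \<open>0\<close> separately.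
\<close>

definition valuation_ring :: "('a::field \<Rightarrow> int) \<Rightarrow> 'a set" where
  "valuation_ring val = {x. x = 0 \<or> 0 \<le> val x}"

definition maximal_ideal :: "('a::field \<Rightarrow> int) \<Rightarrow> 'a set" where
  "maximal_ideal val = {x. x = 0 \<or> 1 \<le> val x}"

definition residue_field :: "('a::field \<Rightarrow> int) \<Rightarrow> 'a set set" where
  "residue_field val =
     valuation_ring val //
       {(x, y). x \<in> valuation_ring val \<and> y \<in> valuation_ring val \<and> x - y \<in> maximal_ideal val}"

definition vabs :: "('a::field \<Rightarrow> int) \<Rightarrow> 'a \<Rightarrow> real" where
  "vabs val x = (if x = 0 then 0 else real (card (residue_field val)) powi (- val x))"

locale nonarch_local_field =
  fixes val :: "'a::field \<Rightarrow> int"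
  assumes val_mult: "x \<noteq> 0 \<Longrightarrow> y \<noteq> 0 \<Longrightarrow> val (x * y) = val x + val y"
    and val_add: "x \<noteq> 0 \<Longrightarrow> y \<noteq> 0 \<Longrightarrow> x + y \<noteq> 0 \<Longrightarrow> min (val x) (val y) \<le> val (x + y)"
    and uniformizer: "\<exists>\<pi>. \<pi> \<noteq> 0 \<and> val \<pi> = 1"
    and finite_residue_field: "finite (residue_field val)"
    and complete: "Metric_space.mcomplete UNIV (\<lambda>x y. vabs val (x - y))"


section \<open>The space \<open>K\<^sup>d\<close> and the projective space\<close>

text \<open>
  The coordinates are indexed by a finite linearly ordered type \<open>'d\<close>, so that \<open>d = CARD('d)\<close>;
  the order is needed for the canonical representatives of lines.
\<close>

definition supnorm :: "('a::field \<Rightarrow> int) \<Rightarrow> 'a ^ 'd::finite \<Rightarrow> real" where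
  "supnorm val x = Max (range (\<lambda>i. vabs val (x $ i)))"

definition vec_topology :: "('a::field \<Rightarrow> int) \<Rightarrow> ('a ^ 'd::finite) topology" where
  "vec_topology val = Metric_space.mtopology UNIV (\<lambda>x y. supnorm val (x - y))"

definition integral_vecs :: "('a::field \<Rightarrow> int) \<Rightarrow> ('a ^ 'd::finite) set" where
  "integral_vecs val = {x. \<forall>i. x $ i \<in> valuation_ring val}"

definition unit_sphere :: "('a::field \<Rightarrow> int) \<Rightarrow> ('a ^ 'd::finite) set" where
  "unit_sphere val = {x. supnorm val x = 1}"

definition proj_space :: "('a::field ^ 'd::finite) set set" where
  "proj_space = {range (\<lambda>c. c *s v) | v. v \<noteq> 0}"

definition proj_dist ::
    "('a::field \<Rightarrow> int) \<Rightarrow> ('a ^ 'd::finite) set \<Rightarrow> ('a ^ 'd) set \<Rightarrow> real" where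
  "proj_dist val a b =
     Inf {supnorm val (u - v) | u v. u \<in> a \<inter> unit_sphere val \<and> v \<in> b \<inter> unit_sphere val}"

definition can :: "('a::field \<Rightarrow> int) \<Rightarrow> ('a ^ 'd::{finite,linorder}) set \<Rightarrow> 'a ^ 'd::{finite,linorder}" where
  "can val a =
     (THE u. u \<in> a \<inter> unit_sphere val \<and> (\<exists>j. u $ j = 1 \<and> (\<forall>i<j. vabs val (u $ i) < 1)))"


section \<open>Haar measures\<close>

text \<open>
  Haar measures of an abelian topological group, given by its topology \<open>X\<close> and its addition
  \<open>add\<close>. No regularity is required: the groups considered below are locally compact and second
  countable, where it is automatic.
\<close>

definition haar_measure :: "'g topology \<Rightarrow> ('g \<Rightarrow> 'g \<Rightarrow> 'g) \<Rightarrow> 'g measure \<Rightarrow> bool" where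
  "haar_measure X add M \<longleftrightarrow>
     space M = topspace X \<and>
     sets M = sigma_sets (topspace X) {U. openin X U} \<and>
     emeasure M (space M) \<noteq> 0 \<and>
     (\<forall>C. compactin X C \<longrightarrow> emeasure M C < \<infinity>) \<and>
     (\<forall>g\<in>topspace X. \<forall>A\<in>sets M. emeasure M (add g ` A) = emeasure M A)"


section \<open>Random Kakeya sets\<close>

text \<open>
  Functions on the projective space are represented by functions that are \<open>undefined\<close> off
  \<open>proj_space\<close>, so that equality on \<open>proj_space\<close> is equality.
\<close>

definition lipschitz_funs ::
    "('a::field \<Rightarrow> int) \<Rightarrow> (('a ^ 'd::finite) set \<Rightarrow> 'a ^ 'd) set" where
  "lipschitz_funs val =
     {f \<in> proj_space \<rightarrow>\<^sub>E integral_vecs val.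
        \<forall>a\<in>proj_space. \<forall>b\<in>proj_space. supnorm val (f a - f b) \<le> proj_dist val a b}"

definition lipschitz_add ::
    "(('a::field ^ 'd::finite) set \<Rightarrow> 'a ^ 'd) \<Rightarrow> (('a ^ 'd) set \<Rightarrow> 'a ^ 'd) \<Rightarrow>
     ('a ^ 'd) set \<Rightarrow> 'a ^ 'd" where
  "lipschitz_add f g = (\<lambda>a\<in>proj_space. f a + g a)"

text \<open>
  The value 0 outside \<open>lipschitz_funs\<close>, where the supremum need not exist, is a dummy: the
  locale \<open>Metric_space\<close> demands nonnegativity and symmetry on the whole type.
\<close>

definition unif_dist ::
    "('a::field \<Rightarrow> int) \<Rightarrow> (('a ^ 'd::finite) set \<Rightarrow> 'a ^ 'd) \<Rightarrow>
     (('a ^ 'd) set \<Rightarrow> 'a ^ 'd) \<Rightarrow> real" where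
  "unif_dist val f g =
     (if f \<in> lipschitz_funs val \<and> g \<in> lipschitz_funs val
      then SUP a\<in>proj_space. supnorm val (f a - g a) else 0)"

definition lipschitz_topology ::
    "('a::field \<Rightarrow> int) \<Rightarrow> (('a ^ 'd::finite) set \<Rightarrow> 'a ^ 'd) topology" where
  "lipschitz_topology val = Metric_space.mtopology (lipschitz_funs val) (unif_dist val)"

definition kakeya_set ::
    "('a::field \<Rightarrow> int) \<Rightarrow> (('a ^ 'd::{finite,linorder}) set \<Rightarrow> 'a ^ 'd::{finite,linorder}) \<Rightarrow>
     ('a ^ 'd::{finite,linorder}) set" where
  "kakeya_set val f = (\<Union>a\<in>proj_space. {t *s can val a + f a | t. t \<in> valuation_ring val})"

definition neighbourhood ::
    "('a::field \<Rightarrow> int) \<Rightarrow> real \<Rightarrow> ('a ^ 'd::finite) set \<Rightarrow> ('a ^ 'd) set" where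
  "neighbourhood val \<epsilon> S = {x. (INF y\<in>S. supnorm val (x - y)) \<le> \<epsilon>}"

end

theory Submission
  imports Defs "HOL-Real_Asymp.Real_Asymp"
begin

text \<open>
  Translating \<open>f\<close> by a constant translates \<open>N(f)\<close>, so for \<open>\<epsilon> = q\<^sup>-\<^sup>n\<close> the expected measure is the
  probability that \<open>0\<close> lies in \<open>N(f)\<close> modulo \<open>\<pi>\<^sup>n\<close>, i.e. that some line \<open>a\<close> satisfies
  \<open>f(a) \<in> R can(a)\<close> modulo \<open>\<pi>\<^sup>n\<close>. The residue classes of such lines form a critical Galton-Watson
  tree: the root has \<open>(q\<^sup>d - 1) / (q - 1)\<close> potential children, every other vertex has \<open>m = q\<^sup>d\<^sup>-\<^sup>1\<close>, and each child
  is kept independently with probability \<open>1 / m\<close>. Both independence and this probability follow from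
  the invariance of the Haar measure under perturbations of \<open>f\<close> supported on a single residue class.
  The survival probability \<open>\<theta>\<close> of a branch satisfies \<open>\<theta>\<^sub>n\<^sub>+\<^sub>1 = (1 - (1 - \<theta>\<^sub>n)\<^sup>m) / m\<close>, hence
  \<open>1 / \<theta>\<^sub>n\<^sub>+\<^sub>1 - 1 / \<theta>\<^sub>n\<close> tends to \<open>(m - 1) / 2\<close> and \<open>\<theta>\<^sub>n\<close> is equivalent to \<open>2 / ((m - 1) n)\<close>.
\<close>

section \<open>Critical branching with binomial offspring\<close>

text \<open>The measure on the functions is known only through translation invariance: neither a
  product structure nor independent digits are given. Conditional independence is therefore replaced
  by a symmetry of events (\<open>stable\<close>): an event may be conditioned upon as long as it is
  unchanged by perturbations that live on one residue class and are divisible by \<pi>^k. Such an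
  event is cut into q^(d-1) pieces, all translates of one event, and this alone yields the
  conditional probability 1/m: the error left at level k is a vector modulo \<pi>, a change of the
  parameter t absorbs its component along the line, and one value of the remaining d-1 digits is
  right. A line can be refined in d-1 coordinates as well, since its canonical representative has
  one coordinate frozen at 1. This coincidence makes the process critical and the decay as slow as
  1/n. The concrete events depend on f only modulo some \<pi>^n, so they are open and hence
  measurable. In the final constant, (q^d-1)/(q-1) comes from the root and 2/(q^(d-1)-1) from the
  second-order term of the survival recursion.\<close>

lemma cesaro_differences:
  fixes X :: "nat \<Rightarrow> real"
  assumes "(\<lambda>n. X (Suc n) - X n) \<longlonglongrightarrow> c"
  shows "(\<lambda>n. X n / real n) \<longlonglongrightarrow> c"
proof (rule LIMSEQ_I)
  fix e :: real assume e: "e > 0"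
  obtain N where N: "\<And>n. n \<ge> N \<Longrightarrow> \<bar>X (Suc n) - X n - c\<bar> < e / 2"
    using LIMSEQ_D[OF assms, of "e / 2"] e by auto
  define A where "A = \<bar>X N - c * real N\<bar>"
  \<comment> \<open>Telescoping from \<open>N\<close>, each further difference is off by less than
    \<open>e / 2\<close>. The other half of \<open>e\<close> is reserved for the fixed initial error
    \<open>A\<close>.\<close>
  have bound: "\<bar>X n - c * real n\<bar> \<le> A + e / 2 * (real n - real N)" if "n \<ge> N" for n
    using that
  proof (induction n rule: dec_induct)
    case base
    then show ?case by (simp add: A_def)
  next
    case (step n)
    have "X (Suc n) - c * real (Suc n) = (X n - c * real n) + (X (Suc n) - X n - c)"
      by (simp add: algebra_simps)
    then show ?case
      using step.IH N[OF step.hyps(1)] by (simp only: of_nat_Suc distrib_left right_diff_distrib)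
  qed
  obtain K :: nat where K: "2 * A / e < real K"
    using reals_Archimedean2 by blast
  have "norm (X n / real n - c) < e" if n: "n \<ge> max (Suc N) K" for n
  proof -
    have pos: "real n > 0" using n by simp
    have "2 * A / e < real n" using K n by linarith
    then have "A < e / 2 * real n" using e by (simp add: field_simps)
    moreover have "e / 2 * (real n - real N) \<le> e / 2 * real n"
      using e by simp
    ultimately have "\<bar>X n - c * real n\<bar> < e * real n"
      using bound[of n] n by simp
    moreover have "X n / real n - c = (X n - c * real n) / real n"
      using pos by (simp add: field_simps)
    ultimately show ?thesis
      using pos by (simp add: field_simps)
  qed
  then show "\<exists>no. \<forall>n\<ge>no. norm (X n / real n - c) < e" by blast
qed

text \<open>Multiplying Bernoulli's inequality for exponent \<open>m - 1\<close> by
  \<open>1 - x\<close> leaves a surplus \<open>(m - 1) * x^2\<close>, which makes it strict. The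
  strictness excludes a positive fixed point of the critical recursion.\<close>

lemma bernoulli_strict:
  fixes x :: real
  assumes "0 < x" "x \<le> 1" "m \<ge> 2"
  shows "1 - real m * x < (1 - x) ^ m"
proof -
  have "1 - real (m - 1) * x \<le> (1 - x) ^ (m - 1)"
    using Bernoulli_inequality[of "-x" "m - 1"] assms by simp
  then have "(1 - real (m - 1) * x) * (1 - x) \<le> (1 - x) ^ (m - 1) * (1 - x)"
    using assms by (intro mult_right_mono) auto
  also have "\<dots> = (1 - x) ^ m"
    using assms by (simp add: power_eq_if)
  finally have *: "(1 - real (m - 1) * x) * (1 - x) \<le> (1 - x) ^ m" .
  have "(1 - real (m - 1) * x) * (1 - x) = 1 - real m * x + real (m - 1) * x * x"
    using assms by (simp add: algebra_simps of_nat_diff)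
  moreover have "real (m - 1) * x * x > 0"
    using assms by simp
  ultimately show ?thesis using * by linarith
qed

text \<open>Extinction probability within n generations of the Galton-Watson process with offspring
  law Binomial(m, 1/m): the n-th iterate at 0 of the generating function (1 - (1 - s)/m)^m.
  Generation 0 consists of the living ancestor, hence the value 0.\<close>

fun extinct :: "nat \<Rightarrow> nat \<Rightarrow> real" where
  "extinct m 0 = 0"
| "extinct m (Suc n) = (1 - (1 - extinct m n) / real m) ^ m"

text \<open>The \<theta> of the overview: a potential child is kept, with probability 1/m, and its
  subtree then reaches n further generations.\<close>

definition branch_survival :: "nat \<Rightarrow> nat \<Rightarrow> real" where
  "branch_survival m n = (1 - extinct m n) / real m"

lemma branch_survival_Suc:
  "branch_survival m (Suc n) = (1 - (1 - branch_survival m n) ^ m) / real m"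
  by (simp add: branch_survival_def)

lemma branch_survival_0: "branch_survival m 0 = 1 / real m"
  by (simp add: branch_survival_def)

lemma branch_survival_bounds:
  assumes "m \<ge> 2"
  shows "0 < branch_survival m n \<and> branch_survival m n < 1"
proof (induction n)
  case 0
  then show ?case using assms by (simp add: branch_survival_0)
next
  case (Suc n)
  let ?x = "branch_survival m n"
  have "(1 - ?x) ^ m < 1"
    using Suc assms power_Suc_less_one[of "1 - ?x" "m - 1"] by simp
  moreover have "0 \<le> (1 - ?x) ^ m" using Suc by simp
  ultimately have "0 < 1 - (1 - ?x) ^ m \<and> 1 - (1 - ?x) ^ m < real m" using assms by linarith
  then show ?case using assms by (simp add: branch_survival_Suc)
qed

text \<open>The sequence decreases, and its limit is a fixed point of the recursion. By
  \<open>bernoulli_strict\<close> the only fixed point in the unit interval is 0.\<close>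

lemma branch_survival_tendsto_0:
  assumes "m \<ge> 2"
  shows "branch_survival m \<longlonglongrightarrow> 0"
proof -
  let ?t = "branch_survival m"
  note b = branch_survival_bounds[OF assms]
  have step: "?t (Suc n) \<le> ?t n" for n
  proof -
    have "1 - (1 - ?t n) ^ m \<le> real m * ?t n"
      using bernoulli_strict[of "?t n" m] b[of n] assms by simp
    then show ?thesis using assms by (simp add: branch_survival_Suc field_simps)
  qed
  have "decseq ?t" by (rule decseq_SucI) (rule step)
  then obtain L where L: "?t \<longlonglongrightarrow> L" "\<And>n. L \<le> ?t n"
    using decseq_convergent[of ?t 0] b by (metis less_imp_le)
  have "0 \<le> L" using LIMSEQ_le_const[OF L(1), of 0] b by (meson less_imp_le)
  have "L \<le> 1" using L(2)[of 0] b[of 0] by linarith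
  have "(\<lambda>n. (1 - (1 - ?t n) ^ m) / real m) \<longlonglongrightarrow> (1 - (1 - L) ^ m) / real m"
    using assms by (intro tendsto_intros L) auto
  moreover have "(\<lambda>n. (1 - (1 - ?t n) ^ m) / real m) \<longlonglongrightarrow> L"
    using LIMSEQ_Suc[OF L(1)] by (simp add: branch_survival_Suc)
  ultimately have "L = (1 - (1 - L) ^ m) / real m"
    using LIMSEQ_unique by blast
  then have "(1 - L) ^ m = 1 - real m * L" using assms by (simp add: field_simps)
  then have "L = 0"
    using bernoulli_strict[of L m] \<open>0 \<le> L\<close> \<open>L \<le> 1\<close> assms by force
  then show ?thesis using L by simp
qed

lemma branch_survival_at_right:
  assumes "m \<ge> 2"
  shows "filterlim (branch_survival m) (at_right 0) sequentially"
proof -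
  have "branch_survival m n \<noteq> 0" for n
    using branch_survival_bounds[OF assms, of n] by simp
  then show ?thesis
    using branch_survival_tendsto_0[OF assms] branch_survival_bounds[OF assms]
    by (auto simp: filterlim_at intro!: always_eventually)
qed

lemma branch_survival_asymp:
  assumes "m \<ge> 2"
  shows "(\<lambda>n. real n * branch_survival m n) \<longlonglongrightarrow> 2 / (real m - 1)"
proof -
  let ?t = "branch_survival m"
  note b = branch_survival_bounds[OF assms]
  \<comment> \<open>The recursion map is x - (m-1)/2 * x^2 + O(x^3). Its linear coefficient is 1 by
    criticality, so passing to reciprocals turns it into an almost constant increment, read off from
    the quadratic coefficient.\<close>
  have "((\<lambda>x::real. 1 / ((1 - (1 - x) ^ m) / real m) - 1 / x) \<longlongrightarrow> (real m - 1) / 2) (at_right 0)"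
    using assms by real_asymp
  then have "(\<lambda>n. 1 / ((1 - (1 - ?t n) ^ m) / real m) - 1 / ?t n) \<longlonglongrightarrow> (real m - 1) / 2"
    by (rule filterlim_compose[OF _ branch_survival_at_right[OF assms]])
  then have "(\<lambda>n. 1 / ?t (Suc n) - 1 / ?t n) \<longlonglongrightarrow> (real m - 1) / 2"
    by (simp add: branch_survival_Suc)
  then have "(\<lambda>n. (1 / ?t n) / real n) \<longlonglongrightarrow> (real m - 1) / 2"
    by (rule cesaro_differences)
  then have "(\<lambda>n. inverse ((1 / ?t n) / real n)) \<longlonglongrightarrow> inverse ((real m - 1) / 2)"
    using assms by (intro tendsto_inverse) auto
  then show ?thesis by (simp add: field_simps)
qed

text \<open>With r independent branches the survival probability is asymptotically r times that of
  one branch. The factor is \<open>Suc n\<close> because the edge from the root to a branch accounts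
  for one more level.\<close>

lemma forest_survival_asymp:
  assumes "m \<ge> 2"
  shows "(\<lambda>n. real (Suc n) * (1 - (1 - branch_survival m n) ^ r)) \<longlonglongrightarrow> 2 * real r / (real m - 1)"
proof -
  let ?t = "branch_survival m"
  note b = branch_survival_bounds[OF assms]
  have quot: "((\<lambda>x::real. (1 - (1 - x) ^ r) / x) \<longlongrightarrow> real r) (at_right 0)"
    by (cases "r = 0") (simp, real_asymp)
  have "(\<lambda>n. (1 - (1 - ?t n) ^ r) / ?t n) \<longlonglongrightarrow> real r"
    by (rule filterlim_compose[OF quot branch_survival_at_right[OF assms]])
  moreover have "(\<lambda>n. real n * ?t n + ?t n) \<longlonglongrightarrow> 2 / (real m - 1) + 0"
    by (intro tendsto_add branch_survival_asymp branch_survival_tendsto_0 assms)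
  ultimately have "(\<lambda>n. (real n * ?t n + ?t n) * ((1 - (1 - ?t n) ^ r) / ?t n))
      \<longlonglongrightarrow> (2 / (real m - 1) + 0) * real r"
    by (intro tendsto_mult)
  moreover have "(real n * ?t n + ?t n) * ((1 - (1 - ?t n) ^ r) / ?t n)
      = real (Suc n) * (1 - (1 - ?t n) ^ r)" for n
    using b[of n] by (simp add: field_simps)
  ultimately show ?thesis by simp
qed

type_synonym ('k, 'n) line_map = "('k, 'n) vec set \<Rightarrow> ('k, 'n) vec"

section \<open>Valuations and the sup norm\<close>

context nonarch_local_field
begin

lemma val_one [simp]: "val 1 = 0"
  using val_mult[of 1 1] by simp

lemma val_minus [simp]: "val (- x) = val x"
proof (cases "x = 0")
  case False
  have "val ((-1) * (-1)) = val (-1) + val (-1)" by (rule val_mult) auto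
  then have "val (-1) = 0" by simp
  then show ?thesis using val_mult[of "-1" x] False by simp
qed simp

text \<open>The norm takes only the value 0 and powers of q, so nearly all estimates can be phrased
  as membership in these powers of the maximal ideal, that is, as congruences modulo
  \<pi>^n.\<close>

definition ideal_pow :: "nat \<Rightarrow> 'a set" where
  "ideal_pow n = {x. x = 0 \<or> int n \<le> val x}"

lemma valuation_ring_eq: "valuation_ring val = ideal_pow 0"
  and maximal_ideal_eq: "maximal_ideal val = ideal_pow 1"
  by (auto simp: valuation_ring_def maximal_ideal_def ideal_pow_def)

lemma ideal_pow_0 [simp]: "0 \<in> ideal_pow n"
  by (simp add: ideal_pow_def)

lemma ideal_pow_add: "x \<in> ideal_pow n \<Longrightarrow> y \<in> ideal_pow n \<Longrightarrow> x + y \<in> ideal_pow n"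
  using val_add[of x y] by (cases "x = 0"; cases "y = 0"; cases "x + y = 0")
    (auto simp: ideal_pow_def)

lemma ideal_pow_minus [simp]: "- x \<in> ideal_pow n \<longleftrightarrow> x \<in> ideal_pow n"
  by (simp add: ideal_pow_def)

lemma ideal_pow_diff: "x \<in> ideal_pow n \<Longrightarrow> y \<in> ideal_pow n \<Longrightarrow> x - y \<in> ideal_pow n"
  using ideal_pow_add[of x n "-y"] by simp

lemma ideal_pow_mult: "x \<in> ideal_pow n \<Longrightarrow> y \<in> ideal_pow k \<Longrightarrow> x * y \<in> ideal_pow (n + k)"
  using val_mult[of x y] by (cases "x = 0"; cases "y = 0") (auto simp: ideal_pow_def)

lemma ideal_pow_antimono: "k \<le> n \<Longrightarrow> ideal_pow n \<subseteq> ideal_pow k"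
  by (auto simp: ideal_pow_def)

lemma one_ideal_pow [simp]: "1 \<in> ideal_pow n \<longleftrightarrow> n = 0"
  by (simp add: ideal_pow_def)

definition unif :: 'a where "unif = (SOME \<pi>. \<pi> \<noteq> 0 \<and> val \<pi> = 1)"

lemma unif: "unif \<noteq> 0" "val unif = 1"
  using someI_ex[OF uniformizer] by (auto simp: unif_def)

lemma unif_power: "unif ^ n \<noteq> 0" "val (unif ^ n) = int n"
  by (induction n) (use unif val_mult[of unif] in auto)

lemma ideal_pow_unif_mult [simp]: "unif ^ n * x \<in> ideal_pow (n + k) \<longleftrightarrow> x \<in> ideal_pow k"
  using val_mult[of "unif ^ n" x] unif_power[of n]
  by (cases "x = 0") (auto simp: ideal_pow_def)

lemma ideal_pow_unif_mult_Suc [simp]: "unif ^ n * x \<in> ideal_pow (Suc n) \<longleftrightarrow> x \<in> ideal_pow 1"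
  using ideal_pow_unif_mult[of n x 1] by simp

lemma ideal_pow_unif_mult_0 [simp]: "unif ^ n * x \<in> ideal_pow n \<longleftrightarrow> x \<in> ideal_pow 0"
  using ideal_pow_unif_mult[of n x 0] by simp

section \<open>The residue field and representatives of its elements\<close>

abbreviation q :: nat where "q \<equiv> card (residue_field val)"

lemma equiv_residue:
  "equiv (ideal_pow 0) {(x, y). x \<in> ideal_pow 0 \<and> y \<in> ideal_pow 0 \<and> x - y \<in> ideal_pow 1}"
proof (rule equivI)
  show "sym {(x, y). x \<in> ideal_pow 0 \<and> y \<in> ideal_pow 0 \<and> x - y \<in> ideal_pow 1}"
    using ideal_pow_minus[of "x - y" 1 for x y] by (auto simp: sym_def)
  show "trans {(x, y). x \<in> ideal_pow 0 \<and> y \<in> ideal_pow 0 \<and> x - y \<in> ideal_pow 1}"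
    using ideal_pow_add[of "x - y" 1 "y - z" for x y z] by (auto simp: trans_def)
qed (auto simp: refl_on_def)

lemma residue_field_eq:
  "residue_field val =
    ideal_pow 0 // {(x, y). x \<in> ideal_pow 0 \<and> y \<in> ideal_pow 0 \<and> x - y \<in> ideal_pow 1}"
  by (simp add: residue_field_def valuation_ring_eq maximal_ideal_eq)

text \<open>One element from each residue class. Digits are thus elements of the ring itself and can
  be multiplied by powers of \<open>unif\<close>.\<close>

definition residues :: "'a set" where
  "residues = (\<lambda>X. SOME x. x \<in> X) ` residue_field val"

lemma
  shows finite_residues: "finite residues"
    and card_residues: "card residues = q"
    and residues_integral: "residues \<subseteq> ideal_pow 0"
    and residue_ex1: "x \<in> ideal_pow 0 \<Longrightarrow> \<exists>!s. s \<in> residues \<and> x - s \<in> ideal_pow 1"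
proof -
  let ?r = "{(x, y). x \<in> ideal_pow 0 \<and> y \<in> ideal_pow 0 \<and> x - y \<in> ideal_pow 1}"
  let ?c = "\<lambda>X::'a set. SOME x. x \<in> X"
  have c: "?c X \<in> X" if "X \<in> residue_field val" for X
    using in_quotient_imp_non_empty[OF equiv_residue that[unfolded residue_field_eq]]
    by (auto intro: someI)
  have disj: "X = Y" if "X \<in> residue_field val" "Y \<in> residue_field val" "x \<in> X" "y \<in> Y" "(x, y) \<in> ?r"
    for X Y x y
    using quotient_eqI[OF equiv_residue that(1,2)[unfolded residue_field_eq] that(3-5)] .
  have sub: "X \<subseteq> ideal_pow 0" if "X \<in> residue_field val" for X
    using in_quotient_imp_subset[OF equiv_residue that[unfolded residue_field_eq]] .
  have rel: "(x, y) \<in> ?r" if "X \<in> residue_field val" "x \<in> X" "y \<in> X" for X x y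
    using quotient_eq_iff[OF equiv_residue that(1,1)[unfolded residue_field_eq] that(2,3)] by simp
  show "finite residues" using finite_residue_field by (simp add: residues_def)
  have "inj_on ?c (residue_field val)"
  proof (rule inj_onI)
    fix X Y assume XY: "X \<in> residue_field val" "Y \<in> residue_field val" "?c X = ?c Y"
    then show "X = Y" using disj[OF XY(1,2) c c] rel c by (metis (no_types, lifting))
  qed
  then show "card residues = q" by (simp add: residues_def card_image)
  show "residues \<subseteq> ideal_pow 0" using c sub by (fastforce simp: residues_def)
  assume x: "x \<in> ideal_pow 0"
  define X where "X = ?r `` {x}"
  have X: "X \<in> residue_field val" unfolding residue_field_eq X_def using x by (rule quotientI)
  have xX: "x \<in> X" using x by (simp add: X_def)
  show "\<exists>!s. s \<in> residues \<and> x - s \<in> ideal_pow 1"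
  proof (intro ex1I conjI)
    show "?c X \<in> residues" using X by (auto simp: residues_def)
    show "x - ?c X \<in> ideal_pow 1" using rel[OF X xX c[OF X]] by simp
  next
    fix s assume s: "s \<in> residues \<and> x - s \<in> ideal_pow 1"
    then obtain Y where Y: "Y \<in> residue_field val" "s = ?c Y" by (auto simp: residues_def)
    then have "X = Y" using disj[OF X Y(1) xX c[OF Y(1)]] s x sub c by blast
    then show "s = ?c X" using Y by simp
  qed
qed

text \<open>The classes of 0 and 1 differ because 1 is not in the maximal ideal. This makes the
  powers of q strictly monotone, on which the translation between norms and ideals rests.\<close>

lemma q_ge_2: "2 \<le> q"
proof -
  obtain s where s: "s \<in> residues" "0 - s \<in> ideal_pow 1" using residue_ex1[of 0] by auto
  obtain t where t: "t \<in> residues" "1 - t \<in> ideal_pow 1" using residue_ex1[of 1] by auto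
  have "s \<noteq> t"
  proof
    assume "s = t"
    then have "(1 - t) - (0 - s) \<in> ideal_pow 1" using s t ideal_pow_diff by blast
    then show False using \<open>s = t\<close> by simp
  qed
  then have "card {s, t} = 2" by simp
  moreover have "card {s, t} \<le> card residues" using s t finite_residues by (intro card_mono) auto
  ultimately show ?thesis using card_residues by simp
qed

lemma real_q_gt_1: "1 < real q"
  using q_ge_2 by linarith

section \<open>The absolute value in terms of the ideals\<close>

lemma vabs_0 [simp]: "vabs val 0 = 0"
  by (simp add: vabs_def)

lemma vabs_nonneg [simp]: "0 \<le> vabs val x"
  by (simp add: vabs_def)

lemma vabs_eq_0 [simp]: "vabs val x = 0 \<longleftrightarrow> x = 0"
  using real_q_gt_1 by (simp add: vabs_def)

lemma vabs_le_powi: "vabs val x \<le> real q powi (- int n) \<longleftrightarrow> x \<in> ideal_pow n"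
  using real_q_gt_1 power_int_strict_increasing[of "- int n" "- val x" "real q"]
    power_int_increasing[of "- val x" "- int n" "real q"]
  by (auto simp: vabs_def ideal_pow_def not_le[symmetric])

text \<open>Discreteness of the norm: no value lies strictly between q^(-n-1) and q^(-n).\<close>

lemma vabs_not_ideal_pow: "x \<notin> ideal_pow (Suc n) \<Longrightarrow> real q powi (- int n) \<le> vabs val x"
  using real_q_gt_1 by (auto simp: vabs_def ideal_pow_def intro!: power_int_increasing)

lemma vabs_le_one: "vabs val x \<le> 1 \<longleftrightarrow> x \<in> ideal_pow 0"
  using vabs_le_powi[of x 0] by simp

lemma vabs_less_one: "vabs val x < 1 \<longleftrightarrow> x \<in> ideal_pow 1"
proof
  assume "vabs val x < 1"
  then show "x \<in> ideal_pow 1" using vabs_not_ideal_pow[of x 0] by fastforce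
next
  assume "x \<in> ideal_pow 1"
  then have "vabs val x \<le> real q powi (- 1)" using vabs_le_powi[of x 1] by simp
  also have "\<dots> < 1" using real_q_gt_1 by (simp add: power_int_minus field_simps)
  finally show "vabs val x < 1" .
qed

lemma vabs_eq_one: "vabs val x = 1 \<longleftrightarrow> x \<in> ideal_pow 0 \<and> x \<notin> ideal_pow 1"
  using vabs_le_one[of x] vabs_less_one[of x] by linarith

lemma vabs_mult: "vabs val (x * y) = vabs val x * vabs val y"
  using real_q_gt_1 val_mult[of x y] power_int_add[of "real q" "- val x" "- val y"]
  by (auto simp: vabs_def)

lemma vabs_minus [simp]: "vabs val (- x) = vabs val x"
  by (simp add: vabs_def)

lemma vabs_add: "vabs val (x + y) \<le> max (vabs val x) (vabs val y)"
proof (cases "x = 0 \<or> y = 0 \<or> x + y = 0")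
  case False
  then have "real q powi (- val (x + y)) \<le> real q powi (- min (val x) (val y))"
    using real_q_gt_1 val_add[of x y] by (intro power_int_increasing) auto
  also have "\<dots> \<le> max (vabs val x) (vabs val y)"
    using False by (auto simp: vabs_def min_def)
  finally show ?thesis using False by (simp add: vabs_def)
qed (auto simp: le_max_iff_disj)

section \<open>Vectors modulo powers of the uniformizer\<close>

definition vpow :: "nat \<Rightarrow> ('a ^ 'd::finite) set" where
  "vpow n = {x. \<forall>i. x $ i \<in> ideal_pow n}"

lemma integral_vecs_eq: "integral_vecs val = vpow 0"
  by (simp add: integral_vecs_def vpow_def valuation_ring_eq)

lemma vpow_0 [simp]: "0 \<in> vpow n"
  by (simp add: vpow_def)

lemma vpow_add: "x \<in> vpow n \<Longrightarrow> y \<in> vpow n \<Longrightarrow> x + y \<in> vpow n"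
  by (simp add: vpow_def ideal_pow_add)

lemma vpow_minus [simp]: "- x \<in> vpow n \<longleftrightarrow> x \<in> vpow n"
  by (simp add: vpow_def)

lemma vpow_diff: "x \<in> vpow n \<Longrightarrow> y \<in> vpow n \<Longrightarrow> x - y \<in> vpow n"
  by (simp add: vpow_def ideal_pow_diff)

lemma vpow_diff_commute: "x - y \<in> vpow n \<longleftrightarrow> y - x \<in> vpow n"
  using vpow_minus[of "x - y" n] by simp

lemma vpow_diff_trans: "x - y \<in> vpow n \<Longrightarrow> y - z \<in> vpow n \<Longrightarrow> x - z \<in> vpow n"
  using vpow_add[of "x - y" n "y - z"] by simp

lemma vpow_scale: "c \<in> ideal_pow n \<Longrightarrow> x \<in> vpow k \<Longrightarrow> c *s x \<in> vpow (n + k)"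
  by (simp add: vpow_def ideal_pow_mult)

lemma vpow_scale_left: "c \<in> ideal_pow 0 \<Longrightarrow> x \<in> vpow k \<Longrightarrow> c *s x \<in> vpow k"
  and vpow_scale_right: "c \<in> ideal_pow k \<Longrightarrow> x \<in> vpow 0 \<Longrightarrow> c *s x \<in> vpow k"
  using vpow_scale[of c 0 x k] vpow_scale[of c k x 0] by auto

lemma vpow_antimono: "k \<le> n \<Longrightarrow> vpow n \<subseteq> vpow k"
  using ideal_pow_antimono[of k n] by (auto simp: vpow_def)

lemma vpow_integral: "x \<in> vpow n \<Longrightarrow> x \<in> vpow 0"
  using vpow_antimono[of 0 n] by auto

lemma vpow_unif_scale_Suc [simp]: "unif ^ n *s x \<in> vpow (Suc n) \<longleftrightarrow> x \<in> vpow 1"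
  and vpow_unif_scale_0 [simp]: "unif ^ n *s x \<in> vpow n \<longleftrightarrow> x \<in> vpow 0"
  by (simp_all add: vpow_def)

lemma vpowE:
  assumes "x \<in> vpow n"
  obtains y where "y \<in> vpow 0" "x = unif ^ n *s y"
proof
  show "x = unif ^ n *s (\<chi> i. x $ i / unif ^ n)" using unif_power by (simp add: vec_eq_iff)
  then show "(\<chi> i. x $ i / unif ^ n) \<in> vpow 0" using assms vpow_unif_scale_0 by metis
qed

section \<open>The sup norm in terms of congruences\<close>

lemma supnorm_le: "supnorm val x \<le> c \<longleftrightarrow> (\<forall>i. vabs val (x $ i) \<le> c)"
  by (simp add: supnorm_def)

lemma supnorm_less: "supnorm val x < c \<longleftrightarrow> (\<forall>i. vabs val (x $ i) < c)"
  by (simp add: supnorm_def)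

lemma vabs_nth_le_supnorm: "vabs val (x $ i) \<le> supnorm val x"
  using supnorm_le[of x "supnorm val x"] by simp

lemma supnorm_attained: "\<exists>i. supnorm val x = vabs val (x $ i)"
proof -
  have "supnorm val x \<in> range (\<lambda>i. vabs val (x $ i))"
    unfolding supnorm_def by (rule Max_in) auto
  then show ?thesis by auto
qed

lemma supnorm_nonneg [simp]: "0 \<le> supnorm val x"
  using supnorm_attained[of x] by auto

lemma supnorm_0 [simp]: "supnorm val 0 = 0"
  using supnorm_attained[of 0] by auto

lemma supnorm_eq_0 [simp]: "supnorm val x = 0 \<longleftrightarrow> x = 0"
proof
  assume "supnorm val x = 0"
  then have "vabs val (x $ i) \<le> 0" for i using vabs_nth_le_supnorm[of x i] by simp
  then show "x = 0" using vabs_nonneg by (metis vabs_eq_0 order_antisym vec_eq_iff zero_index)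
qed simp

lemma supnorm_minus_commute: "supnorm val (x - y) = supnorm val (y - x)"
  using vabs_minus[of "x $ i - y $ i" for i] by (simp add: supnorm_def)

lemma supnorm_add: "supnorm val (x + y) \<le> max (supnorm val x) (supnorm val y)"
  unfolding supnorm_le
  using vabs_add vabs_nth_le_supnorm
  by (smt (verit, best) max.mono order_trans vector_add_component)

lemma supnorm_triangle: "supnorm val (x - z) \<le> supnorm val (x - y) + supnorm val (y - z)"
  using supnorm_add[of "x - y" "y - z"] supnorm_nonneg[of "x - y"] supnorm_nonneg[of "y - z"]
  by (simp del: supnorm_nonneg)

lemma supnorm_scale: "supnorm val (c *s x) = vabs val c * supnorm val x"
proof (rule antisym)
  show "supnorm val (c *s x) \<le> vabs val c * supnorm val x"
    by (simp add: supnorm_le vabs_mult vabs_nth_le_supnorm mult_left_mono)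
  obtain i where "supnorm val x = vabs val (x $ i)" using supnorm_attained by auto
  then show "vabs val c * supnorm val x \<le> supnorm val (c *s x)"
    using vabs_nth_le_supnorm[of "c *s x" i] by (simp add: vabs_mult)
qed

lemma supnorm_le_powi: "supnorm val x \<le> real q powi (- int n) \<longleftrightarrow> x \<in> vpow n"
  by (simp add: supnorm_le vabs_le_powi vpow_def)

lemma supnorm_le_one: "supnorm val x \<le> 1 \<longleftrightarrow> x \<in> vpow 0"
  using supnorm_le_powi[of x 0] by simp

lemma supnorm_less_one: "supnorm val x < 1 \<longleftrightarrow> x \<in> vpow 1"
  by (simp add: supnorm_less vabs_less_one vpow_def)

lemma supnorm_not_vpow:
  assumes "x \<notin> vpow (Suc n)"
  shows "real q powi (- int n) \<le> supnorm val x"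
proof -
  obtain i where "x $ i \<notin> ideal_pow (Suc n)" using assms by (auto simp: vpow_def)
  then show ?thesis using vabs_not_ideal_pow vabs_nth_le_supnorm order_trans by blast
qed

lemma unit_sphere_iff: "x \<in> unit_sphere val \<longleftrightarrow> x \<in> vpow 0 \<and> x \<notin> vpow 1"
  using supnorm_le_one[of x] supnorm_less_one[of x] by (auto simp: unit_sphere_def)

text \<open>The norm of a nonzero integral vector is exactly some q^(-n), attained at a coordinate,
  so that single n already gives the comparison. This turns the Lipschitz condition into
  preservation of congruences.\<close>

lemma supnorm_le_iff_vpow:
  assumes "y \<in> vpow 0"
  shows "supnorm val x \<le> supnorm val y \<longleftrightarrow> (\<forall>n. y \<in> vpow n \<longrightarrow> x \<in> vpow n)"
proof
  assume "supnorm val x \<le> supnorm val y"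
  then show "\<forall>n. y \<in> vpow n \<longrightarrow> x \<in> vpow n"
    unfolding supnorm_le_powi[symmetric] by auto
next
  assume *: "\<forall>n. y \<in> vpow n \<longrightarrow> x \<in> vpow n"
  show "supnorm val x \<le> supnorm val y"
  proof (cases "y = 0")
    case True
    have "x $ i = 0" for i
    proof -
      \<comment> \<open>For a nonzero entry this exponent exceeds its valuation by one. The
        integrality stated next keeps \<open>nat\<close> from truncating it.\<close>
      have "x $ i \<in> ideal_pow (nat (val (x $ i) + 1))"
        using * True by (auto simp: vpow_def)
      moreover have "x $ i \<in> ideal_pow 0" using * True by (auto simp: vpow_def)
      ultimately show ?thesis by (auto simp: ideal_pow_def)
    qed
    then have "x = 0" by (simp add: vec_eq_iff)
    then show ?thesis by simp
  next
    case False
    obtain i where i: "supnorm val y = vabs val (y $ i)" using supnorm_attained by auto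
    with False have nz: "y $ i \<noteq> 0" using supnorm_eq_0[of y] by force
    then have "0 \<le> val (y $ i)" using assms by (auto simp: vpow_def ideal_pow_def)
    then have "supnorm val y = real q powi (- int (nat (val (y $ i))))"
      using i nz by (simp add: vabs_def)
    then show ?thesis using * supnorm_le_powi by (metis order_refl)
  qed
qed

declare One_nat_def [simp del]

section \<open>Canonical representatives\<close>

text \<open>The condition that singles out \<open>can\<close>, in terms of congruences:
  \<open>j\<close> is the first coordinate that does not vanish in the residue field, as in a
  reduced echelon form.\<close>

definition pivot :: "'a ^ 'd::{finite,linorder} \<Rightarrow> 'd \<Rightarrow> bool" where
  "pivot u j \<longleftrightarrow> u \<in> vpow 0 \<and> u $ j = 1 \<and> (\<forall>i<j. u $ i \<in> ideal_pow 1)"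

text \<open>The pivot index can be read off modulo \<pi>: the smaller of two different indices would
  carry a 1 in one vector and a non-unit in the other.\<close>

lemma pivot_cong:
  assumes "pivot u j" "pivot v k" "u - v \<in> vpow 1"
  shows "j = k"
proof -
  have *: "\<not> j < k" if "pivot u j" "pivot v k" "u - v \<in> vpow 1" for u v :: "'a ^ 'd::{finite,linorder}" and j k
  proof
    assume "j < k"
    then have "v $ j \<in> ideal_pow 1" "u $ j = 1" using that by (auto simp: pivot_def)
    moreover have "u $ j - v $ j \<in> ideal_pow 1" using that(3) by (simp add: vpow_def)
    ultimately have "1 - v $ j \<in> ideal_pow 1" "v $ j \<in> ideal_pow 1" by simp_all
    then show False using ideal_pow_add[of "1 - v $ j" 1 "v $ j"] by simp
  qed
  show ?thesis
    using *[OF assms] *[OF assms(2,1)] assms(3) vpow_diff_commute[of u v] by (meson linorder_neqE)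
qed

lemma pivot_unit_sphere:
  assumes "pivot u j"
  shows "u \<in> unit_sphere val"
proof -
  have "u $ j \<notin> ideal_pow 1" using assms by (simp add: pivot_def)
  then have "u \<notin> vpow 1" by (auto simp: vpow_def)
  then show ?thesis using assms by (simp add: unit_sphere_iff pivot_def)
qed

text \<open>Both vectors have norm 1, so c is a unit and preserves the set of coordinates in the
  maximal ideal. Hence the pivots agree, and comparing the entries there gives c = 1.\<close>

lemma pivot_scale_eq:
  assumes "pivot u j" "pivot (c *s u) k"
  shows "c = 1"
proof -
  have c: "vabs val c = 1"
    using pivot_unit_sphere[OF assms(1)] pivot_unit_sphere[OF assms(2)]
    by (simp add: unit_sphere_def supnorm_scale)
  have "c * u $ i \<in> ideal_pow 1 \<longleftrightarrow> u $ i \<in> ideal_pow 1" for i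
    using c unfolding vabs_less_one[symmetric] vabs_mult by simp
  then have "\<not> k < j" "\<not> j < k"
    using assms unfolding pivot_def
    by (metis one_ideal_pow one_neq_zero vector_smult_component)+
  then have "j = k" by simp
  then show ?thesis using assms by (simp add: pivot_def)
qed

lemma ex_pivot_scale:
  fixes v :: "'a ^ 'd::{finite,linorder}"
  assumes "v \<noteq> 0"
  shows "\<exists>c j. c \<noteq> 0 \<and> pivot (c *s v) j"
proof -
  \<comment> \<open>Dividing by the first coordinate of maximal norm gives 1 there, and the earlier
    coordinates, of strictly smaller norm, become non-units.\<close>
  define A where "A = {i. vabs val (v $ i) = supnorm val v}"
  define j where "j = Min A"
  have "A \<noteq> {}" using supnorm_attained[of v] by (auto simp: A_def)
  then have "j \<in> A" unfolding j_def by (intro Min_in) auto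
  then have j: "vabs val (v $ j) = supnorm val v" by (simp add: A_def)
  have vj: "v $ j \<noteq> 0" using j assms supnorm_eq_0[of v] by force
  have less: "vabs val (v $ i) < supnorm val v" if "i < j" for i
  proof -
    have "i \<notin> A" using that unfolding j_def by (meson Min_le finite leD)
    then show ?thesis using vabs_nth_le_supnorm[of v i] by (simp add: A_def)
  qed
  have inv: "vabs val (1 / v $ j) = 1 / supnorm val v"
  proof -
    have "vabs val (1 / v $ j) * vabs val (v $ j) = vabs val 1"
      using vj by (simp flip: vabs_mult)
    moreover have "vabs val 1 = 1" by (simp add: vabs_eq_one)
    ultimately have "vabs val (1 / v $ j) * supnorm val v = 1" using j by simp
    moreover have "supnorm val v \<noteq> 0" using assms by simp
    ultimately show ?thesis by (simp add: nonzero_eq_divide_eq)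
  qed
  have pos: "0 < supnorm val v" using assms supnorm_nonneg[of v] supnorm_eq_0[of v] by linarith
  have "supnorm val ((1 / v $ j) *s v) \<le> 1"
    using inv pos by (simp add: supnorm_scale)
  then have "(1 / v $ j) *s v \<in> vpow 0" by (simp only: supnorm_le_one)
  moreover have "1 / v $ j * v $ i \<in> ideal_pow 1" if "i < j" for i
    using inv less[OF that] pos unfolding vabs_less_one[symmetric] vabs_mult by simp
  ultimately have "pivot ((1 / v $ j) *s v) j" using vj by (simp add: pivot_def)
  then show ?thesis using vj by (metis divide_eq_0_iff one_neq_zero)
qed

definition line :: "'a ^ 'd \<Rightarrow> ('a ^ 'd::finite) set" where
  "line v = range (\<lambda>c. c *s v)"

lemma line_scale:
  assumes "c \<noteq> 0"
  shows "line (c *s v) = line v"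
proof (intro equalityI subsetI)
  fix x assume "x \<in> line v"
  then obtain e where "x = e *s v" by (auto simp: line_def)
  then have "x = (e / c) *s (c *s v)" using assms by simp
  then show "x \<in> line (c *s v)" unfolding line_def by blast
qed (auto simp: line_def)

lemma can_line:
  assumes "pivot u j"
  shows "can val (line u) = u"
  unfolding can_def
proof (rule the_equality)
  show "u \<in> line u \<inter> unit_sphere val \<and> (\<exists>j. u $ j = 1 \<and> (\<forall>i<j. vabs val (u $ i) < 1))"
    using assms pivot_unit_sphere[OF assms] rangeI[of "\<lambda>c. c *s u" 1]
    by (auto simp: line_def pivot_def vabs_less_one)
next
  fix w
  assume w: "w \<in> line u \<inter> unit_sphere val \<and> (\<exists>j. w $ j = 1 \<and> (\<forall>i<j. vabs val (w $ i) < 1))"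
  then obtain c where c: "w = c *s u" by (auto simp: line_def)
  from w obtain k where "pivot w k"
    by (auto simp: pivot_def vabs_less_one unit_sphere_iff)
  then show "w = u" using pivot_scale_eq[OF assms] c by force
qed

lemma line_in_proj_space:
  assumes "pivot u j"
  shows "line u \<in> proj_space"
proof -
  have "u \<noteq> 0" using assms by (auto simp: pivot_def)
  then show ?thesis by (auto simp: proj_space_def line_def)
qed

lemma proj_spaceE:
  fixes a :: "('a ^ 'd::{finite,linorder}) set"
  assumes "a \<in> proj_space"
  obtains j where "pivot (can val a) j" "a = line (can val a)"
proof -
  obtain v where v: "v \<noteq> 0" "a = line v" using assms by (auto simp: proj_space_def line_def)
  obtain c j where c: "c \<noteq> 0" "pivot (c *s v) j" using ex_pivot_scale[OF v(1)] by auto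
  have a: "a = line (c *s v)" using v c by (simp add: line_scale)
  then have "can val a = c *s v" using can_line[OF c(2)] by simp
  then show thesis using that a c by metis
qed

lemma can_integral [simp]: "a \<in> proj_space \<Longrightarrow> can val a \<in> vpow 0"
  using proj_spaceE[of a] by (metis pivot_def)

text \<open>Canonical representatives realise the infimum. If the multiples c * can(a) and e *
  can(b) are at distance r < 1, their reductions have the same zero pattern and thus a common pivot;
  there they differ by c - e, so replacing e by c costs at most r. For r at least 1, the integrality
  of the representatives suffices.\<close>

lemma proj_dist_eq:
  fixes a b :: "('a ^ 'd::{finite,linorder}) set"
  assumes a: "a \<in> proj_space" and b: "b \<in> proj_space"
  shows "proj_dist val a b = supnorm val (can val a - can val b)"
  unfolding proj_dist_def
proof (rule cInf_eq_minimum)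
  obtain j where j: "pivot (can val a) j" "a = line (can val a)" using proj_spaceE[OF a] .
  obtain k where k: "pivot (can val b) k" "b = line (can val b)" using proj_spaceE[OF b] .
  have "can val a \<in> a" "can val b \<in> b"
    using j(2) k(2) rangeI[of "\<lambda>c. c *s can val a" 1] rangeI[of "\<lambda>c. c *s can val b" 1]
    by (auto simp: line_def)
  then show "supnorm val (can val a - can val b)
      \<in> {supnorm val (u - v) |u v. u \<in> a \<inter> unit_sphere val \<and> v \<in> b \<inter> unit_sphere val}"
    using pivot_unit_sphere j(1) k(1) by blast
  fix r assume "r \<in> {supnorm val (u - v) |u v. u \<in> a \<inter> unit_sphere val \<and> v \<in> b \<inter> unit_sphere val}"
  then obtain u v where r: "r = supnorm val (u - v)"
    and uv: "u \<in> a" "u \<in> unit_sphere val" "v \<in> b" "v \<in> unit_sphere val" by auto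
  obtain c where c: "u = c *s can val a" using uv(1) j(2) by (auto simp: line_def)
  obtain e where e: "v = e *s can val b" using uv(3) k(2) by (auto simp: line_def)
  have "supnorm val (can val a) = 1" "supnorm val (can val b) = 1"
    using pivot_unit_sphere j(1) k(1) by (auto simp: unit_sphere_def)
  then have c1: "vabs val c = 1" and e1: "vabs val e = 1"
    using uv c e by (auto simp: unit_sphere_def supnorm_scale)
  have c0: "c \<noteq> 0" and e0: "e \<noteq> 0" using c1 e1 by auto
  show "supnorm val (can val a - can val b) \<le> r"
  proof (cases "r < 1")
    case False
    have "can val a - can val b \<in> vpow 0" using a b by (intro vpow_diff can_integral)
    then show ?thesis using False by (simp flip: supnorm_le_one)
  next
    case True
    have scal: "c * x \<in> ideal_pow 1 \<longleftrightarrow> x \<in> ideal_pow 1" "e * x \<in> ideal_pow 1 \<longleftrightarrow> x \<in> ideal_pow 1" for x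
      using c1 e1 unfolding vabs_less_one[symmetric] vabs_mult by simp_all
    have diff: "c * can val a $ i - e * can val b $ i \<in> ideal_pow 1" for i
      using True r c e by (simp add: supnorm_less_one vpow_def)
    have cong: "can val a $ i \<in> ideal_pow 1 \<longleftrightarrow> can val b $ i \<in> ideal_pow 1" for i
      using diff[of i] scal[of "can val a $ i"] scal[of "can val b $ i"]
        ideal_pow_add[OF diff[of i], of "e * can val b $ i"]
        ideal_pow_diff[of "c * can val a $ i" 1, OF _ diff[of i]] by auto
    have jk: "j = k"
    proof (rule linorder_cases[of j k])
      assume "j < k"
      then show ?thesis using j(1) k(1) cong[of j] by (simp add: pivot_def)
    next
      assume "k < j"
      then show ?thesis using j(1) k(1) cong[of k] by (simp add: pivot_def)
    qed
    \<comment> \<open>At the common pivot both canonical representatives have entry 1, so this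
      coordinate compares the two scaling factors.\<close>
    have "u $ j - v $ j = c - e" using c e j k jk by (simp add: pivot_def)
    then have ce: "vabs val (c - e) \<le> r"
      using vabs_nth_le_supnorm[of "u - v" j] r by simp
    have "c *s (can val a - can val b) = (u - v) + (e - c) *s can val b"
      using c e by (simp add: vec_eq_iff algebra_simps)
    then have "supnorm val (can val a - can val b)
        \<le> max (supnorm val (u - v)) (supnorm val ((e - c) *s can val b))"
      using supnorm_scale[of c "can val a - can val b"] c1 supnorm_add by (metis mult_1)
    also have "supnorm val ((e - c) *s can val b) = vabs val (c - e)"
      using \<open>supnorm val (can val b) = 1\<close> vabs_minus[of "c - e"]
      unfolding supnorm_scale by simp
    finally show ?thesis using ce r by simp
  qed
qed

lemma lipschitz_funs_iff:
  fixes f :: "('a, 'd::{finite,linorder}) line_map"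
  shows "f \<in> lipschitz_funs val \<longleftrightarrow> f \<in> proj_space \<rightarrow>\<^sub>E vpow 0 \<and>
    (\<forall>a\<in>proj_space. \<forall>b\<in>proj_space. \<forall>n. can val a - can val b \<in> vpow n \<longrightarrow> f a - f b \<in> vpow n)"
proof -
  have "supnorm val (f a - f b) \<le> proj_dist val a b \<longleftrightarrow>
      (\<forall>n. can val a - can val b \<in> vpow n \<longrightarrow> f a - f b \<in> vpow n)"
    if "a \<in> proj_space" "b \<in> proj_space" for a b
    unfolding proj_dist_eq[OF that] using that by (intro supnorm_le_iff_vpow vpow_diff) auto
  then show ?thesis unfolding lipschitz_funs_def integral_vecs_eq by blast
qed

section \<open>Residue classes of lines\<close>

text \<open>Free digits on \<open>I\<close>, the entries of \<open>u\<close> elsewhere. It occurs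
  with \<open>-{j}\<close> for the refinements of a line with pivot \<open>j\<close>, with
  \<open>{j<..}\<close> for lines modulo \<pi>, and with \<open>UNIV\<close> for all residue
  vectors.\<close>

definition transversal :: "'d::{finite,linorder} set \<Rightarrow> 'a ^ 'd::{finite,linorder} \<Rightarrow> ('a ^ 'd::{finite,linorder}) set" where
  "transversal I u = {w. \<forall>i. if i \<in> I then w $ i \<in> residues else w $ i = u $ i}"

lemma card_transversal:
  "finite (transversal I u)" "card (transversal I u) = q ^ card I"
proof -
  let ?T = "PiE UNIV (\<lambda>i. if i \<in> I then residues else {u $ i})"
  have eq: "transversal I u = vec_lambda ` ?T"
  proof (intro equalityI subsetI)
    fix w assume "w \<in> transversal I u"
    then have "vec_nth w \<in> ?T" by (auto simp: transversal_def PiE_UNIV_domain split: if_splits)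
    then show "w \<in> vec_lambda ` ?T" by (intro image_eqI[of w vec_lambda "vec_nth w"]) auto
  next
    fix w assume "w \<in> vec_lambda ` ?T"
    then obtain g where g: "w = vec_lambda g" "g \<in> ?T" by blast
    have "if i \<in> I then g i \<in> residues else g i = u $ i" for i
      using PiE_mem[OF g(2), of i] by (simp split: if_splits)
    then show "w \<in> transversal I u" using g(1) by (simp add: transversal_def)
  qed
  have inj: "inj_on vec_lambda ?T" by (auto intro!: inj_onI simp: vec_lambda_inject)
  have "card ?T = (\<Prod>i\<in>UNIV. if i \<in> I then q else 1)"
    by (subst card_PiE) (auto simp: card_residues intro!: prod.cong)
  then show "card (transversal I u) = q ^ card I"
    by (simp add: eq card_image[OF inj] prod.If_cases)
  show "finite (transversal I u)"
    unfolding eq by (intro finite_imageI finite_PiE) (auto simp: finite_residues)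
qed

lemma transversal_integral: "w \<in> transversal I u \<Longrightarrow> u \<in> vpow 0 \<Longrightarrow> w \<in> vpow 0"
  using residues_integral by (auto simp: transversal_def vpow_def split: if_splits)

lemma transversal_ex1:
  assumes "z \<in> vpow 0" "\<And>i. i \<notin> I \<Longrightarrow> z $ i - u $ i \<in> ideal_pow 1"
  shows "\<exists>!w. w \<in> transversal I u \<and> z - w \<in> vpow 1"
proof -
  define r where "r x = (THE s. s \<in> residues \<and> x - s \<in> ideal_pow 1)" for x
  have r: "r (z $ i) \<in> residues" "z $ i - r (z $ i) \<in> ideal_pow 1" for i
    using theI'[OF residue_ex1[of "z $ i"]] assms(1) by (auto simp: r_def vpow_def)
  show ?thesis
  proof (intro ex1I)
    show "(\<chi> i. if i \<in> I then r (z $ i) else u $ i) \<in> transversal I u \<and>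
        z - (\<chi> i. if i \<in> I then r (z $ i) else u $ i) \<in> vpow 1"
      using r assms by (auto simp: transversal_def vpow_def)
    fix w assume w: "w \<in> transversal I u \<and> z - w \<in> vpow 1"
    have "w $ i = r (z $ i)" if "i \<in> I" for i
      using residue_ex1[of "z $ i"] r[of i] w that assms(1)
      by (auto simp: transversal_def vpow_def)
    then show "w = (\<chi> i. if i \<in> I then r (z $ i) else u $ i)"
      using w by (auto simp: vec_eq_iff transversal_def)
  qed
qed

text \<open>The source of the probability 1/m. Let \<pi>^k z be the error at level k. Changing t by
  a multiple of \<pi>^k moves z along c, so z only matters modulo c and can be normalised to vanish
  at the pivot. The remaining d-1 coordinates modulo \<pi> then determine the digit vector
  w.\<close>

lemma lifting_ex1:
  assumes c: "pivot c j" and t: "t \<in> ideal_pow 0" "t *s c + x \<in> vpow k"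
  shows "\<exists>!w. w \<in> transversal (-{j}) 0 \<and>
    (\<exists>s\<in>ideal_pow 0. s *s c + (x + unif ^ k *s w) \<in> vpow (Suc k))"
proof -
  have c0: "c \<in> vpow 0" and cj: "c $ j = 1" using c by (auto simp: pivot_def)
  obtain z where z: "z \<in> vpow 0" "t *s c + x = unif ^ k *s z" using vpowE[OF t(2)] by blast
  have x: "x = unif ^ k *s z - t *s c" using z(2) by (metis add_diff_cancel_left')
  \<comment> \<open>Minus the component of z transversal to c. Since c is 1 at the pivot,
    subtracting z from z_j * c clears that coordinate, matching the condition w_j = 0.\<close>
  define y where "y = (z $ j) *s c - z"
  have y: "y \<in> vpow 0" "y $ j = 0"
  proof -
    have "z $ j \<in> ideal_pow 0" using z(1) by (simp add: vpow_def)
    then show "y \<in> vpow 0" unfolding y_def using z(1) c0 by (intro vpow_diff vpow_scale_left)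
    show "y $ j = 0" by (simp add: y_def cj)
  qed
  have key: "(\<exists>s\<in>ideal_pow 0. s *s c + (x + unif ^ k *s w) \<in> vpow (Suc k)) \<longleftrightarrow> y - w \<in> vpow 1"
    if w: "w \<in> transversal (-{j}) 0" for w
  proof
    have wj: "w $ j = 0" and w0: "w \<in> vpow 0"
      using w transversal_integral[OF w] by (auto simp: transversal_def)
    assume "\<exists>s\<in>ideal_pow 0. s *s c + (x + unif ^ k *s w) \<in> vpow (Suc k)"
    then obtain s where s: "s *s c + (x + unif ^ k *s w) \<in> vpow (Suc k)" by auto
    have e: "s *s c + (x + unif ^ k *s w) = (s - t) *s c + unif ^ k *s (z + w)"
      by (simp add: x vec_eq_iff algebra_simps)
    \<comment> \<open>The pivot coordinate, where c is 1 and w is 0, fixes s modulo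
      \<pi>^(k+1).\<close>
    have "((s - t) *s c + unif ^ k *s (z + w)) $ j \<in> ideal_pow (Suc k)"
      using s unfolding e by (simp add: vpow_def)
    then have "(s - t) + unif ^ k * z $ j \<in> ideal_pow (Suc k)" using wj cj by simp
    then have "((s - t) + unif ^ k * z $ j) *s c \<in> vpow (Suc k)"
      using c0 by (rule vpow_scale_right)
    then have "((s - t) + unif ^ k * z $ j) *s c - (s *s c + (x + unif ^ k *s w)) \<in> vpow (Suc k)"
      using s by (rule vpow_diff)
    moreover have "((s - t) + unif ^ k * z $ j) *s c - (s *s c + (x + unif ^ k *s w))
        = unif ^ k *s (y - w)"
      unfolding e by (simp add: vec_eq_iff y_def algebra_simps)
    ultimately have "unif ^ k *s (y - w) \<in> vpow (Suc k)" by metis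
    then show "y - w \<in> vpow 1" by (simp only: vpow_unif_scale_Suc)
  next
    assume "y - w \<in> vpow 1"
    then have "- (unif ^ k *s (y - w)) \<in> vpow (Suc k)" by (simp only: vpow_minus vpow_unif_scale_Suc)
    moreover have "(t - unif ^ k * z $ j) *s c + (x + unif ^ k *s w) = - (unif ^ k *s (y - w))"
      by (simp add: x vec_eq_iff y_def algebra_simps)
    moreover have "t - unif ^ k * z $ j \<in> ideal_pow 0"
      using t(1) z(1) ideal_pow_unif_mult_0[of k "z $ j"] ideal_pow_antimono[of 0 k]
      by (intro ideal_pow_diff) (auto simp: vpow_def)
    ultimately show "\<exists>s\<in>ideal_pow 0. s *s c + (x + unif ^ k *s w) \<in> vpow (Suc k)" by metis
  qed
  have "\<exists>!w. w \<in> transversal (-{j}) 0 \<and> y - w \<in> vpow 1"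
    using y by (intro transversal_ex1) auto
  then show ?thesis using key by blast
qed

text \<open>On \<open>proj_space\<close> these classes are the closed balls of radius q^(-k), by
  \<open>proj_dist_eq\<close>. A vertex of the tree at level k is such a class, represented by any
  line in it.\<close>

definition same_class :: "nat \<Rightarrow> ('a ^ 'd::{finite,linorder}) set \<Rightarrow> ('a ^ 'd::{finite,linorder}) set \<Rightarrow> bool" where
  "same_class k a b \<longleftrightarrow> can val a - can val b \<in> vpow k"

lemma same_class_refl [simp]: "same_class k a a"
  by (simp add: same_class_def)

lemma same_class_sym: "same_class k a b \<Longrightarrow> same_class k b a"
  using vpow_diff_commute by (auto simp: same_class_def)

lemma same_class_trans: "same_class k a b \<Longrightarrow> same_class k b c \<Longrightarrow> same_class k a c"
  using vpow_diff_trans by (auto simp: same_class_def)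

lemma same_class_antimono: "same_class n a b \<Longrightarrow> k \<le> n \<Longrightarrow> same_class k a b"
  using vpow_antimono by (auto simp: same_class_def)

lemma ex1_image:
  assumes "\<exists>!w. w \<in> T \<and> P w" "\<And>w. w \<in> T \<Longrightarrow> Q (g w) \<longleftrightarrow> P w"
  shows "\<exists>!b. b \<in> g ` T \<and> Q b"
  using assms by blast

text \<open>From level 1 on, all lines of a class share their pivot, whose entry is frozen at 1.
  Each of the other d-1 coordinates receives a free digit at \<pi>^k, and adding these digits does
  not disturb the pivot.\<close>

lemma class_children:
  fixes a :: "('a ^ 'd::{finite,linorder}) set"
  assumes a: "a \<in> proj_space" and k: "1 \<le> k"
  obtains B where "finite B" "card B = q ^ (CARD('d) - 1)" "B \<subseteq> proj_space"
    "\<And>b. b \<in> B \<Longrightarrow> same_class k b a"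
    "\<And>c. c \<in> proj_space \<Longrightarrow> same_class k c a \<Longrightarrow> \<exists>!b. b \<in> B \<and> same_class (Suc k) c b"
proof -
  obtain j where j: "pivot (can val a) j" using proj_spaceE[OF a] by blast
  define T where "T = transversal (-{j}) (0 :: 'a ^ 'd::{finite,linorder})"
  define u where "u w = can val a + unif ^ k *s w" for w
  have T: "w \<in> vpow 0" "w $ j = 0" if "w \<in> T" for w
    using that transversal_integral[of w "-{j}" 0] by (auto simp: T_def transversal_def)
  have u: "pivot (u w) j" if "w \<in> T" for w
  proof -
    have w: "unif ^ k *s w \<in> vpow k" using T[OF that] by simp
    then have "unif ^ k *s w \<in> vpow 1" using k vpow_antimono by blast
    then show ?thesis
      using j T[OF that] vpow_add[OF can_integral[OF a] vpow_integral[OF w]]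
      by (auto simp: pivot_def u_def vpow_def intro: ideal_pow_add)
  qed
  have can_u: "can val (line (u w)) = u w" if "w \<in> T" for w
    using can_line[OF u[OF that]] .
  have "inj_on u T"
    using unif_power by (auto simp: inj_on_def u_def)
  then have inj: "inj_on (\<lambda>w. line (u w)) T"
    unfolding inj_on_def by (metis can_u)
  show thesis
  proof (rule that[of "(\<lambda>w. line (u w)) ` T"])
    show "finite ((\<lambda>w. line (u w)) ` T)" by (simp add: T_def card_transversal)
    have "card ((\<lambda>w. line (u w)) ` T) = q ^ card (-{j})"
      by (subst card_image[OF inj]) (simp add: T_def card_transversal)
    then show "card ((\<lambda>w. line (u w)) ` T) = q ^ (CARD('d) - 1)"
      by (simp add: card_Diff_singleton Compl_eq_Diff_UNIV)
    show "(\<lambda>w. line (u w)) ` T \<subseteq> proj_space" using u line_in_proj_space by auto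
  next
    fix b assume "b \<in> (\<lambda>w. line (u w)) ` T"
    then show "same_class k b a" using can_u T by (auto simp: same_class_def u_def)
  next
    fix c assume c: "c \<in> proj_space" "same_class k c a"
    obtain l where l: "pivot (can val c) l" using proj_spaceE[OF c(1)] by blast
    have "l = j"
      using pivot_cong[OF l j] same_class_antimono[OF c(2) k] by (simp add: same_class_def)
    obtain z where z: "z \<in> vpow 0" "can val c - can val a = unif ^ k *s z"
      using vpowE c(2) unfolding same_class_def by blast
    \<comment> \<open>Both representatives have entry 1 at the common pivot, so the difference has
      no digit there.\<close>
    have "unif ^ k * z $ j = can val c $ j - can val a $ j"
      using z(2) by (metis vector_minus_component vector_smult_component)
    then have "z $ j = 0" using l j \<open>l = j\<close> unif by (simp add: pivot_def)
    then have ex1: "\<exists>!w. w \<in> T \<and> z - w \<in> vpow 1"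
      unfolding T_def using z by (intro transversal_ex1) auto
    have iff: "same_class (Suc k) c (line (u w)) \<longleftrightarrow> z - w \<in> vpow 1" if "w \<in> T" for w
    proof -
      have "can val c - u w = unif ^ k *s (z - w)"
        using z(2) by (simp add: u_def vec_eq_iff algebra_simps)
      then show ?thesis by (simp only: same_class_def can_u[OF that] vpow_unif_scale_Suc)
    qed
    show "\<exists>!b. b \<in> (\<lambda>w. line (u w)) ` T \<and> same_class (Suc k) c b"
      using ex1 iff by (rule ex1_image)
  qed
qed

text \<open>In a finite linear order the number of elements above j takes every value below the
  cardinality exactly once.\<close>

lemma sum_power_card_greaterThan:
  "(\<Sum>j\<in>(UNIV :: 'd::{finite,linorder} set). x ^ card {j<..}) = (\<Sum>i<CARD('d). x ^ i)"
proof -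
  let ?c = "\<lambda>j :: 'd. card {j<..}"
  have mono: "?c k < ?c j" if "j < k" for j k
    using that by (intro psubset_card_mono) auto
  have inj: "inj ?c" by (rule injI) (metis mono linorder_neqE less_irrefl)
  have "range ?c \<subseteq> {..<CARD('d)}"
    by (auto intro!: psubset_card_mono)
  then have "range ?c = {..<CARD('d)}"
    by (intro card_subset_eq) (auto simp: card_image[OF inj])
  then show ?thesis
    using sum.reindex[OF inj, of "\<lambda>i. x ^ i"] by simp
qed

text \<open>The points of the projective space over the residue field, counted by cells: with pivot
  j, the earlier coordinates vanish modulo \<pi> and the later ones are free. The cells add up to a
  geometric sum.\<close>

lemma root_children:
  obtains B :: "('a ^ 'd::{finite,linorder}) set set" where "finite B"
    "real (card B) = (real q ^ CARD('d) - 1) / (real q - 1)" "B \<subseteq> proj_space"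
    "\<And>c. c \<in> proj_space \<Longrightarrow> \<exists>!b. b \<in> B \<and> same_class 1 c b"
proof -
  define T :: "'d \<Rightarrow> ('a ^ 'd::{finite,linorder}) set" where "T j = transversal {j<..} (axis j 1)" for j
  define U where "U = (\<Union>j. T j)"
  have ax: "axis j 1 \<in> vpow 0" for j :: 'd by (auto simp: vpow_def axis_def)
  have piv: "pivot w j" if "w \<in> T j" for w j
    using that transversal_integral[OF that[unfolded T_def] ax]
    by (auto simp: pivot_def T_def transversal_def axis_def split: if_splits)
  have can: "can val (line w) = w" and proj: "line w \<in> proj_space" if "w \<in> U" for w
    using that piv can_line line_in_proj_space unfolding U_def by blast+
  have inj: "inj_on line U" using can by (metis inj_onI)
  have fin: "finite (T j)" "card (T j) = q ^ card {j<..}" for j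
    by (simp_all add: T_def card_transversal)
  have disj: "T j \<inter> T k = {}" if "j \<noteq> k" for j k
    using piv pivot_cong[of _ j _ k] that by fastforce
  have "card U = (\<Sum>j\<in>(UNIV :: 'd set). q ^ card {j<..})"
    unfolding U_def using fin disj by (subst card_UN_disjoint) auto
  also have "\<dots> = (\<Sum>i<CARD('d). q ^ i)" by (rule sum_power_card_greaterThan)
  finally have card_U: "card U = (\<Sum>i<CARD('d). q ^ i)" .
  show thesis
  proof (rule that[of "line ` U"])
    show "finite (line ` U)" using fin by (simp add: U_def)
    show "real (card (line ` U)) = (real q ^ CARD('d) - 1) / (real q - 1)"
      using real_q_gt_1 by (simp add: card_image[OF inj] card_U geometric_sum)
    show "line ` U \<subseteq> proj_space" using proj by auto
    fix c :: "('a ^ 'd::{finite,linorder}) set" assume c: "c \<in> proj_space"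
    obtain j where j: "pivot (can val c) j" using proj_spaceE[OF c] by blast
    have ex1: "\<exists>!w. w \<in> T j \<and> can val c - w \<in> vpow 1"
      unfolding T_def
    proof (rule transversal_ex1)
      show "can val c $ i - axis j 1 $ i \<in> ideal_pow 1" if "i \<notin> {j<..}" for i
        using j that by (cases "i = j") (auto simp: pivot_def axis_def)
    qed (use c in auto)
    have "w \<in> T j" if w: "w \<in> U" "can val c - w \<in> vpow 1" for w
      using w pivot_cong[OF j] piv unfolding U_def by blast
    moreover have "w \<in> U" if "w \<in> T j" for w using that by (auto simp: U_def)
    ultimately have "\<exists>!w. w \<in> U \<and> can val c - w \<in> vpow 1"
      using ex1 by (metis (no_types, lifting))
    moreover have "same_class 1 c (line w) \<longleftrightarrow> can val c - w \<in> vpow 1" if "w \<in> U" for w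
      using can[OF that] by (simp add: same_class_def)
    ultimately show "\<exists>!b. b \<in> line ` U \<and> same_class 1 c b"
      by (rule ex1_image)
  qed
qed

section \<open>The group of Lipschitz functions\<close>

lemma lipschitz_funsI:
  fixes f :: "('a, 'd::{finite,linorder}) line_map"
  assumes "f \<in> extensional proj_space" "\<And>a. a \<in> proj_space \<Longrightarrow> f a \<in> vpow 0"
    "\<And>a b n. a \<in> proj_space \<Longrightarrow> b \<in> proj_space \<Longrightarrow> same_class n a b \<Longrightarrow> f a - f b \<in> vpow n"
  shows "f \<in> lipschitz_funs val"
  using assms by (auto simp: lipschitz_funs_iff PiE_def same_class_def)

lemma lipschitz_funsD:
  fixes f :: "('a, 'd::{finite,linorder}) line_map"
  assumes "f \<in> lipschitz_funs val"
  shows "f \<in> extensional proj_space" "a \<in> proj_space \<Longrightarrow> f a \<in> vpow 0"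
    "a \<in> proj_space \<Longrightarrow> b \<in> proj_space \<Longrightarrow> same_class n a b \<Longrightarrow> f a - f b \<in> vpow n"
  using assms by (auto simp: lipschitz_funs_iff PiE_def same_class_def)

lemma lipschitz_add_apply [simp]: "a \<in> proj_space \<Longrightarrow> lipschitz_add f g a = f a + g a"
  by (simp add: lipschitz_add_def)

lemma lipschitz_add_closed:
  fixes f g :: "('a, 'd::{finite,linorder}) line_map"
  assumes f: "f \<in> lipschitz_funs val" and g: "g \<in> lipschitz_funs val"
  shows "lipschitz_add f g \<in> lipschitz_funs val"
proof (rule lipschitz_funsI)
  show "lipschitz_add f g \<in> extensional proj_space" by (simp add: lipschitz_add_def)
  fix a :: "('a ^ 'd::{finite,linorder}) set" assume "a \<in> proj_space"
  then show "lipschitz_add f g a \<in> vpow 0" by (simp add: vpow_add lipschitz_funsD(2) f g)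
next
  fix a b :: "('a ^ 'd::{finite,linorder}) set" and n
  assume ab: "a \<in> proj_space" "b \<in> proj_space" "same_class n a b"
  have "f a + g a - (f b + g b) = (f a - f b) + (g a - g b)" by simp
  also have "\<dots> \<in> vpow n" using lipschitz_funsD(3) f g ab by (intro vpow_add)
  finally show "lipschitz_add f g a - lipschitz_add f g b \<in> vpow n" using ab by simp
qed

lemma proj_space_nonempty: "(proj_space :: ('a ^ 'd::{finite,linorder}) set set) \<noteq> {}"
proof -
  have "(\<chi> i. (1 :: 'a)) \<noteq> (0 :: 'a ^ 'd::{finite,linorder})" by (simp add: vec_eq_iff)
  then show ?thesis by (auto simp: proj_space_def)
qed

lemma unif_dist_le:
  fixes f g :: "('a, 'd::{finite,linorder}) line_map"
  assumes f: "f \<in> lipschitz_funs val" and g: "g \<in> lipschitz_funs val"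
  shows "unif_dist val f g \<le> c \<longleftrightarrow> (\<forall>a\<in>proj_space. supnorm val (f a - g a) \<le> c)"
proof -
  have "supnorm val (f a - g a) \<le> 1" if "a \<in> proj_space" for a
    using that f g by (simp add: supnorm_le_one vpow_diff lipschitz_funsD(2))
  then have "bdd_above ((\<lambda>a. supnorm val (f a - g a)) ` proj_space)"
    by (auto intro!: bdd_aboveI)
  then show ?thesis
    using f g by (simp add: unif_dist_def cSUP_le_iff[OF proj_space_nonempty])
qed

lemma supnorm_le_unif_dist:
  fixes f g :: "('a, 'd::{finite,linorder}) line_map"
  assumes "f \<in> lipschitz_funs val" "g \<in> lipschitz_funs val" "a \<in> proj_space"
  shows "supnorm val (f a - g a) \<le> unif_dist val f g"
  using unif_dist_le[OF assms(1,2), of "unif_dist val f g"] assms(3) by blast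

lemma Metric_space_lipschitz:
  "Metric_space (lipschitz_funs val :: ('a, 'd::{finite,linorder}) line_map set)
     (unif_dist val)"
proof
  fix f g :: "('a, 'd::{finite,linorder}) line_map"
  obtain a :: "('a ^ 'd::{finite,linorder}) set" where a: "a \<in> proj_space"
    using proj_space_nonempty by blast
  show nonneg: "0 \<le> unif_dist val f g"
  proof (cases "f \<in> lipschitz_funs val \<and> g \<in> lipschitz_funs val")
    case True
    then show ?thesis using supnorm_le_unif_dist[of f g a] a supnorm_nonneg order_trans by blast
  next
    case False
    then show ?thesis by (auto simp: unif_dist_def)
  qed
  show "unif_dist val f g = unif_dist val g f"
    using supnorm_minus_commute[of "f a" "g a" for a] by (auto simp: unif_dist_def)
  assume f: "f \<in> lipschitz_funs val" and g: "g \<in> lipschitz_funs val"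
  show "unif_dist val f g = 0 \<longleftrightarrow> f = g"
  proof
    assume "unif_dist val f g = 0"
    then have "supnorm val (f a - g a) \<le> 0" if "a \<in> proj_space" for a
      using supnorm_le_unif_dist[OF f g that] by simp
    then have "f a = g a" if "a \<in> proj_space" for a
      using that supnorm_nonneg[of "f a - g a"] supnorm_eq_0[of "f a - g a"]
      by (metis eq_iff_diff_eq_0 order_antisym)
    then show "f = g" using lipschitz_funsD(1) f g by (blast intro: extensionalityI)
  next
    assume "f = g"
    then have "unif_dist val f g \<le> 0" using unif_dist_le[OF f g] by simp
    then show "unif_dist val f g = 0" using nonneg by simp
  qed
  fix h :: "('a, 'd::{finite,linorder}) line_map"
  assume h: "h \<in> lipschitz_funs val"
  show "unif_dist val f h \<le> unif_dist val f g + unif_dist val g h"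
    unfolding unif_dist_le[OF f h]
    using supnorm_triangle supnorm_le_unif_dist[OF f g] supnorm_le_unif_dist[OF g h]
    by (meson add_mono order_trans)
qed

text \<open>A set of functions that is determined by values modulo \<pi>^n is a union of balls of
  radius q^(-n). This supplies the measurability of all concrete events below.\<close>

lemma openin_lipschitz_topology:
  fixes A :: "('a, 'd::{finite,linorder}) line_map set"
  assumes A: "A \<subseteq> lipschitz_funs val"
    and cyl: "\<And>f g. f \<in> A \<Longrightarrow> g \<in> lipschitz_funs val \<Longrightarrow>
      (\<And>a. a \<in> proj_space \<Longrightarrow> g a - f a \<in> vpow n) \<Longrightarrow> g \<in> A"
  shows "openin (lipschitz_topology val) A"
proof -
  interpret M: Metric_space "lipschitz_funs val :: ('a, 'd::{finite,linorder}) line_map set" "unif_dist val"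
    by (rule Metric_space_lipschitz)
  have "M.mball f (real q powi (- int n)) \<subseteq> A" if "f \<in> A" for f
  proof
    fix g assume g: "g \<in> M.mball f (real q powi (- int n))"
    then have fg: "f \<in> lipschitz_funs val" "g \<in> lipschitz_funs val"
      "unif_dist val f g \<le> real q powi (- int n)" by auto
    have "g a - f a \<in> vpow n" if "a \<in> proj_space" for a
      using fg(3) that unfolding unif_dist_le[OF fg(1,2)]
      by (metis supnorm_le_powi vpow_diff_commute)
    then show "g \<in> A" using cyl \<open>f \<in> A\<close> fg by blast
  qed
  moreover have "0 < real q powi (- int n)" using real_q_gt_1 by simp
  ultimately show ?thesis
    unfolding lipschitz_topology_def M.openin_mtopology using A by blast
qed

lemma topspace_lipschitz_topology:
  "topspace (lipschitz_topology val :: ('a, 'd::{finite,linorder}) line_map topology)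
    = lipschitz_funs val"
proof -
  interpret M: Metric_space "lipschitz_funs val :: ('a, 'd::{finite,linorder}) line_map set" "unif_dist val"
    by (rule Metric_space_lipschitz)
  show ?thesis by (simp add: lipschitz_topology_def)
qed

section \<open>Perturbations supported on one residue class\<close>

definition bump :: "nat \<Rightarrow> ('a ^ 'd::{finite,linorder}) set \<Rightarrow> 'a ^ 'd::{finite,linorder}
    \<Rightarrow> ('a ^ 'd::{finite,linorder}) set \<Rightarrow> 'a ^ 'd::{finite,linorder}" where
  "bump k b w = (\<lambda>a\<in>proj_space. if same_class (Suc k) a b then unif ^ k *s w else 0)"

text \<open>Support and size have separate indices: the choice of digit k for a class at level k+1
  needs size \<pi>^k, whereas once that digit has been tested only perturbations of size \<pi>^(k+1)
  preserve the outcome.\<close>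

definition local_perturbations :: "nat \<Rightarrow> ('a ^ 'd::{finite,linorder}) set \<Rightarrow> nat \<Rightarrow>
    ('a, 'd::{finite,linorder}) line_map set" where
  "local_perturbations k b l = {h \<in> lipschitz_funs val.
     \<forall>a\<in>proj_space. h a \<in> vpow l \<and> (\<not> same_class k a b \<longrightarrow> h a = 0)}"

text \<open>Lines in different classes modulo \<pi>^(k+1) are at distance at least q^(-k), which
  leaves room for a jump divisible by \<pi>^k. Inside a class the bump is constant.\<close>

lemma bump_local_perturbation:
  fixes b :: "('a ^ 'd::{finite,linorder}) set"
  assumes w: "w \<in> vpow 0"
  shows "bump k b w \<in> local_perturbations (Suc k) b k"
proof -
  have val: "unif ^ k *s w \<in> vpow k" using w by simp
  have "bump k b w \<in> lipschitz_funs val"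
  proof (rule lipschitz_funsI)
    show "bump k b w \<in> extensional proj_space" by (simp add: bump_def)
    fix a :: "('a ^ 'd::{finite,linorder}) set" assume "a \<in> proj_space"
    then show "bump k b w a \<in> vpow 0" using vpow_integral[OF val] by (simp add: bump_def)
  next
    fix a c :: "('a ^ 'd::{finite,linorder}) set" and n
    assume ac: "a \<in> proj_space" "c \<in> proj_space" "same_class n a c"
    show "bump k b w a - bump k b w c \<in> vpow n"
    proof (cases "n \<le> k")
      case True
      have "bump k b w a - bump k b w c \<in> vpow k"
        using ac val by (intro vpow_diff) (auto simp: bump_def)
      then show ?thesis using True vpow_antimono by blast
    next
      case False
      then have "same_class (Suc k) a c" using ac same_class_antimono by (metis not_less_eq_eq)
      then have "same_class (Suc k) a b \<longleftrightarrow> same_class (Suc k) c b"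
        using same_class_sym same_class_trans by blast
      then show ?thesis using ac by (simp add: bump_def)
    qed
  qed
  then show ?thesis using val by (simp add: local_perturbations_def bump_def)
qed

section \<open>Lines that pass through 0 modulo a power of the uniformizer\<close>

definition good :: "nat \<Rightarrow> ('a, 'd::{finite,linorder}) line_map
    \<Rightarrow> ('a ^ 'd::{finite,linorder}) set \<Rightarrow> bool" where
  "good n f a \<longleftrightarrow> (\<exists>t\<in>ideal_pow 0. t *s can val a + f a \<in> vpow n)"

text \<open>Survival of a vertex b of level k up to level n. Testing level n is enough for k \<le>
  n: a line good at level n is good at all lower levels, so the whole path down to it is
  kept.\<close>

definition hit :: "nat \<Rightarrow> nat \<Rightarrow> ('a ^ 'd::{finite,linorder}) set
    \<Rightarrow> ('a, 'd::{finite,linorder}) line_map \<Rightarrow> bool" where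
  "hit n k b f \<longleftrightarrow> (\<exists>c\<in>proj_space. same_class k c b \<and> good n f c)"

lemma good_antimono: "good n f a \<Longrightarrow> k \<le> n \<Longrightarrow> good k f a"
  using vpow_antimono by (auto simp: good_def)

lemma good_0: "f \<in> lipschitz_funs val \<Longrightarrow> a \<in> proj_space \<Longrightarrow> good 0 f a"
  using lipschitz_funsD(2)[of f a] by (auto simp: good_def intro!: bexI[of _ 0])

lemma good_perturb:
  assumes "good n f a" "g a - f a \<in> vpow n"
  shows "good n g a"
proof -
  obtain t where t: "t \<in> ideal_pow 0" "t *s can val a + f a \<in> vpow n"
    using assms by (auto simp: good_def)
  have "t *s can val a + g a = (t *s can val a + f a) + (g a - f a)" by simp
  then show ?thesis using t assms(2) vpow_add unfolding good_def by metis
qed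

text \<open>The Lipschitz condition makes goodness at level n a property of the class modulo
  \<pi>^n, hence of the vertex of the tree.\<close>

lemma good_same_class:
  assumes f: "f \<in> lipschitz_funs val" and ab: "a \<in> proj_space" "b \<in> proj_space" "same_class n a b"
    and "good n f a"
  shows "good n f b"
proof -
  obtain t where t: "t \<in> ideal_pow 0" "t *s can val a + f a \<in> vpow n"
    using assms by (auto simp: good_def)
  have "t *s can val b + f b = (t *s can val a + f a) - (t *s (can val a - can val b) + (f a - f b))"
    by (simp add: vec_eq_iff algebra_simps)
  also have "\<dots> \<in> vpow n"
    using ab(3) unfolding same_class_def
    by (rule vpow_diff[OF t(2) vpow_add[OF vpow_scale_left[OF t(1)] lipschitz_funsD(3)[OF f ab]]])
  finally show ?thesis using t(1) by (auto simp: good_def)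
qed

text \<open>Representatives of R^d modulo \<pi>^n, built one digit at a time. They cut R^d into
  finitely many cosets of equal measure.\<close>

lemma vec_residue_system:
  "\<exists>X :: ('a ^ 'd::{finite,linorder}) set. finite X \<and> X \<subseteq> vpow 0 \<and>
    (\<forall>z\<in>vpow 0. \<exists>!x. x \<in> X \<and> z - x \<in> vpow n)"
proof (induction n)
  case 0
  show ?case by (rule exI[of _ "{0}"]) auto
next
  case (Suc n)
  then obtain X :: "('a ^ 'd::{finite,linorder}) set" where X: "finite X" "X \<subseteq> vpow 0"
    "\<And>z. z \<in> vpow 0 \<Longrightarrow> \<exists>!x. x \<in> X \<and> z - x \<in> vpow n" by auto
  define T where "T = transversal UNIV (0 :: 'a ^ 'd::{finite,linorder})"
  have T: "finite T" "T \<subseteq> vpow 0"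
    using card_transversal(1) transversal_integral[of _ UNIV 0] by (auto simp: T_def)
  define Y where "Y = (\<lambda>(x, w). x + unif ^ n *s w) ` (X \<times> T)"
  have shift: "unif ^ n *s w \<in> vpow n" if "w \<in> T" for w using that T by auto
  show ?case
  proof (intro exI[of _ Y] conjI ballI)
    show "finite Y" using X T by (simp add: Y_def)
    show "Y \<subseteq> vpow 0"
      using X T shift by (auto simp: Y_def intro!: vpow_add vpow_integral[OF shift])
    fix z :: "'a ^ 'd::{finite,linorder}" assume z: "z \<in> vpow 0"
    obtain x where x: "x \<in> X" "z - x \<in> vpow n" using X(3)[OF z] by auto
    obtain z' where z': "z' \<in> vpow 0" "z - x = unif ^ n *s z'" using vpowE[OF x(2)] by blast
    have "\<exists>!w. w \<in> T \<and> z' - w \<in> vpow 1"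
      unfolding T_def using z' by (intro transversal_ex1) auto
    then obtain w where w: "w \<in> T" "z' - w \<in> vpow 1" "\<And>v. v \<in> T \<Longrightarrow> z' - v \<in> vpow 1 \<Longrightarrow> v = w"
      by auto
    have iff: "z - (x + unif ^ n *s v) \<in> vpow (Suc n) \<longleftrightarrow> z' - v \<in> vpow 1" for v
    proof -
      have "z - (x + unif ^ n *s v) = unif ^ n *s z' - unif ^ n *s v"
        by (simp flip: z'(2))
      also have "\<dots> = unif ^ n *s (z' - v)" by (simp add: vec_eq_iff algebra_simps)
      finally show ?thesis by (simp only: vpow_unif_scale_Suc)
    qed
    show "\<exists>!y. y \<in> Y \<and> z - y \<in> vpow (Suc n)"
    proof (intro ex1I conjI)
      show "x + unif ^ n *s w \<in> Y"
        using x(1) w(1) unfolding Y_def by (intro image_eqI[of _ _ "(x, w)"]) simp_all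
      show "z - (x + unif ^ n *s w) \<in> vpow (Suc n)" using w(2) iff by blast
      fix y assume y: "y \<in> Y \<and> z - y \<in> vpow (Suc n)"
      then obtain x' v where y': "x' \<in> X" "v \<in> T" "y = x' + unif ^ n *s v" by (auto simp: Y_def)
      \<comment> \<open>Modulo \<pi>^n the last digit disappears, which identifies the earlier part
        before the digit is compared.\<close>
      have "z - y \<in> vpow n" using y vpow_antimono[of n "Suc n"] by auto
      then have "(z - y) + unif ^ n *s v \<in> vpow n" using shift[OF y'(2)] by (rule vpow_add)
      then have "z - x' \<in> vpow n" using y'(3) by simp
      then have "x' = x" using X(3)[OF z] x y'(1) by blast
      then show "y = x + unif ^ n *s w" using y y' w iff by blast
    qed
  qed
qed

section \<open>The metric topology of the vector space and neighbourhoods\<close>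

lemma Metric_space_supnorm:
  "Metric_space UNIV (\<lambda>x y :: 'a ^ 'd::{finite,linorder}. supnorm val (x - y))"
  by standard (use supnorm_minus_commute supnorm_triangle in auto)

lemma openin_coset: "openin (vec_topology val) ((+) x ` (vpow n :: ('a ^ 'd::{finite,linorder}) set))"
proof -
  interpret M: Metric_space UNIV "\<lambda>x y :: 'a ^ 'd::{finite,linorder}. supnorm val (x - y)"
    by (rule Metric_space_supnorm)
  have "M.mball y (real q powi (- int n)) \<subseteq> (+) x ` vpow n" if y: "y \<in> (+) x ` vpow n" for y
  proof
    fix z assume "z \<in> M.mball y (real q powi (- int n))"
    then have "supnorm val (y - z) \<le> real q powi (- int n)" by simp
    then have "y - z \<in> vpow n" by (simp only: supnorm_le_powi)
    moreover have "y - x \<in> vpow n" using y by auto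
    ultimately have "(y - x) - (y - z) \<in> vpow n" using vpow_diff by blast
    then show "z \<in> (+) x ` vpow n" by (intro image_eqI[of z _ "z - x"]) auto
  qed
  moreover have "0 < real q powi (- int n)" using real_q_gt_1 by simp
  ultimately show ?thesis
    unfolding vec_topology_def M.openin_mtopology by blast
qed

lemma topspace_vec_topology: "topspace (vec_topology val :: ('a ^ 'd::{finite,linorder}) topology) = UNIV"
proof -
  interpret M: Metric_space UNIV "\<lambda>x y :: 'a ^ 'd::{finite,linorder}. supnorm val (x - y)"
    by (rule Metric_space_supnorm)
  show ?thesis by (simp add: vec_topology_def)
qed

text \<open>The infimum in the definition of the neighbourhood is attained since the norm takes discrete
  values, so only the power of the uniformizer just below \<open>\<epsilon>\<close> matters.\<close>

lemma neighbourhood_eq: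
  fixes S :: "('a ^ 'd::{finite,linorder}) set"
  assumes S: "S \<noteq> {}" and \<epsilon>: "real q powi (- int (Suc n)) \<le> \<epsilon>" "\<epsilon> < real q powi (- int n)"
  shows "neighbourhood val \<epsilon> S = {x. \<exists>y\<in>S. x - y \<in> vpow (Suc n)}"
proof (intro equalityI subsetI)
  fix x assume "x \<in> neighbourhood val \<epsilon> S"
  then have le: "(INF y\<in>S. supnorm val (x - y)) \<le> \<epsilon>" by (simp add: neighbourhood_def)
  show "x \<in> {x. \<exists>y\<in>S. x - y \<in> vpow (Suc n)}"
  proof (rule ccontr)
    assume "x \<notin> {x. \<exists>y\<in>S. x - y \<in> vpow (Suc n)}"
    then have "real q powi (- int n) \<le> (INF y\<in>S. supnorm val (x - y))"
      using S by (intro cINF_greatest supnorm_not_vpow) auto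
    then show False using le \<epsilon> by linarith
  qed
next
  fix x assume "x \<in> {x. \<exists>y\<in>S. x - y \<in> vpow (Suc n)}"
  then obtain y where y: "y \<in> S" "supnorm val (x - y) \<le> real q powi (- int (Suc n))"
    unfolding supnorm_le_powi by blast
  have "(INF y\<in>S. supnorm val (x - y)) \<le> supnorm val (x - y)"
    using y(1) by (intro cINF_lower bdd_belowI[of _ 0]) auto
  then show "x \<in> neighbourhood val \<epsilon> S" using y \<epsilon> by (simp add: neighbourhood_def)
qed

lemma kakeya_set_nonempty:
  fixes f :: "('a, 'd::{finite,linorder}) line_map"
  shows "kakeya_set val f \<noteq> {}"
proof -
  obtain a :: "('a ^ 'd::{finite,linorder}) set" where "a \<in> proj_space"
    using proj_space_nonempty by blast
  then have "0 *s can val a + f a \<in> kakeya_set val f"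
    unfolding kakeya_set_def valuation_ring_eq using ideal_pow_0[of 0] by blast
  then show ?thesis by blast
qed

end

section \<open>Extinction probabilities of the random tree\<close>

locale random_lipschitz = nonarch_local_field val for val :: "'a::field \<Rightarrow> int" +
  fixes P :: "('a, 'd::{finite,linorder}) line_map measure"
  assumes haar_P: "haar_measure (lipschitz_topology val) lipschitz_add P"
    and prob_P: "prob_space P"
begin

interpretation prob_space P by (rule prob_P)

lemma space_P: "space P = lipschitz_funs val"
  using haar_P by (simp add: haar_measure_def topspace_lipschitz_topology)

lemma sets_P_cylinder:
  assumes "A \<subseteq> lipschitz_funs val"
    and "\<And>f g. f \<in> A \<Longrightarrow> g \<in> lipschitz_funs val \<Longrightarrow>
      (\<And>a. a \<in> proj_space \<Longrightarrow> g a - f a \<in> vpow n) \<Longrightarrow> g \<in> A"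
  shows "A \<in> sets P"
proof -
  have "openin (lipschitz_topology val) A"
    using assms by (rule openin_lipschitz_topology)
  then show ?thesis using haar_P by (auto simp: haar_measure_def)
qed

lemma prob_translate:
  assumes "h \<in> lipschitz_funs val" "A \<in> sets P"
  shows "prob (lipschitz_add h ` A) = prob A"
  using haar_P assms by (simp add: haar_measure_def measure_def topspace_lipschitz_topology)

lemma sets_good: "{f \<in> lipschitz_funs val. \<exists>t\<in>ideal_pow 0. t *s can val a + (f a + x) \<in> vpow n} \<in> sets P"
  if a: "a \<in> proj_space"
proof (rule sets_P_cylinder[where n = n])
  fix f g :: "('a, 'd::{finite,linorder}) line_map"
  assume f: "f \<in> {f \<in> lipschitz_funs val. \<exists>t\<in>ideal_pow 0. t *s can val a + (f a + x) \<in> vpow n}"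
    and g: "g \<in> lipschitz_funs val" "\<And>a. a \<in> proj_space \<Longrightarrow> g a - f a \<in> vpow n"
  obtain t where t: "t \<in> ideal_pow 0" "t *s can val a + (f a + x) \<in> vpow n" using f by auto
  have "t *s can val a + (g a + x) = (t *s can val a + (f a + x)) + (g a - f a)" by simp
  then have "t *s can val a + (g a + x) \<in> vpow n" using t g(2)[OF a] vpow_add by metis
  then show "g \<in> {f \<in> lipschitz_funs val. \<exists>t\<in>ideal_pow 0. t *s can val a + (f a + x) \<in> vpow n}"
    using t g by auto
qed auto

lemma sets_hit: "{f \<in> lipschitz_funs val. hit n k b f} \<in> sets P"
  by (rule sets_P_cylinder[where n = n], blast) (unfold hit_def, blast intro: good_perturb)

text \<open>The substitute for conditional independence: an event with this symmetry carries no
  information about the part of f on the class of b that can be altered by perturbations divisible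
  by \<pi>^l.\<close>

definition stable :: "('a, 'd::{finite,linorder}) line_map set \<Rightarrow> nat
    \<Rightarrow> ('a ^ 'd::{finite,linorder}) set \<Rightarrow> nat \<Rightarrow> bool" where
  "stable D k b l \<longleftrightarrow> D \<in> sets P \<and> (\<forall>f\<in>D. \<forall>h\<in>local_perturbations k b l. lipschitz_add f h \<in> D)"

lemma stable_sub: "stable D k b l \<Longrightarrow> D \<subseteq> lipschitz_funs val"
  using sets.sets_into_space space_P by (fastforce simp: stable_def)

text \<open>By \<open>lifting_ex1\<close> every function in D has exactly one digit vector whose
  bump makes b good at the next level. This partitions D into q^(d-1) pieces, each of which its own
  bump translates onto the event in question.\<close>

lemma prob_good_child:
  assumes b: "b \<in> proj_space" and D: "stable D (Suc k) b k"
    and good: "\<And>f. f \<in> D \<Longrightarrow> good k f b"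
  shows "prob {f \<in> D. good (Suc k) f b} = prob D / real (q ^ (CARD('d) - 1))"
proof -
  obtain j where j: "pivot (can val b) j" using proj_spaceE[OF b] by blast
  define T where "T = transversal (-{j}) (0 :: 'a ^ 'd::{finite,linorder})"
  define G where "G = {f \<in> D. good (Suc k) f b}"
  \<comment> \<open>The functions that become good at b after adding
    \<open>bump k b w\<close>.\<close>
  define A where "A w = {f \<in> D. \<exists>t\<in>ideal_pow 0. t *s can val b + (f b + unif ^ k *s w) \<in> vpow (Suc k)}" for w
  have card_T: "card T = q ^ (CARD('d) - 1)"
    by (simp add: T_def card_transversal card_Diff_singleton Compl_eq_Diff_UNIV)
  have fin_T: "finite T" by (simp add: T_def card_transversal)
  have T_int: "w \<in> vpow 0" if "w \<in> T" for w
    using that transversal_integral[of w "-{j}" 0] by (simp add: T_def)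
  have bump_b: "bump k b w b = unif ^ k *s w" for w using b by (simp add: bump_def)
  have A_sets: "A w \<in> sets P" for w
  proof -
    have "A w = D \<inter> {f \<in> lipschitz_funs val. \<exists>t\<in>ideal_pow 0.
        t *s can val b + (f b + unif ^ k *s w) \<in> vpow (Suc k)}"
      using stable_sub[OF D] by (auto simp: A_def)
    moreover have "\<dots> \<in> sets P"
      using D by (intro sets.Int sets_good b) (simp add: stable_def)
    ultimately show ?thesis by simp
  qed
  have ex1: "\<exists>!w. w \<in> T \<and> f \<in> A w" if f: "f \<in> D" for f
  proof -
    obtain t where "t \<in> ideal_pow 0" "t *s can val b + f b \<in> vpow k"
      using good[OF f] by (auto simp: good_def)
    from lifting_ex1[OF j this] show ?thesis using f by (simp add: A_def T_def)
  qed
  \<comment> \<open>Stability keeps the translate inside D, and the bump with -w provides the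
    inverse.\<close>
  have transl: "lipschitz_add (bump k b w) ` A w = G" if w: "w \<in> T" for w
  proof (intro equalityI subsetI)
    fix g assume "g \<in> lipschitz_add (bump k b w) ` A w"
    then obtain f where f: "f \<in> A w" "g = lipschitz_add (bump k b w) f" by auto
    have "g = lipschitz_add f (bump k b w)"
      using f by (simp add: lipschitz_add_def add.commute)
    moreover have "lipschitz_add f (bump k b w) \<in> D"
      using f(1) D bump_local_perturbation[OF T_int[OF w]] by (auto simp: A_def stable_def)
    moreover have "good (Suc k) g b" using f b by (auto simp: A_def good_def bump_b add.commute)
    ultimately show "g \<in> G" by (simp add: G_def)
  next
    fix g assume g: "g \<in> G"
    define f where "f = lipschitz_add g (bump k b (- w))"
    have fD: "f \<in> D"
      unfolding f_def using g D bump_local_perturbation[of "-w" k b] T_int[OF w]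
      by (auto simp: G_def stable_def)
    have "g = lipschitz_add (bump k b w) f"
    proof (rule extensionalityI[of _ proj_space])
      show "g \<in> extensional proj_space"
        using g stable_sub[OF D] lipschitz_funsD(1) by (auto simp: G_def)
    qed (auto simp: f_def lipschitz_add_def bump_def)
    moreover have "f \<in> A w"
      using fD g b by (auto simp: A_def G_def good_def f_def bump_b)
    ultimately show "g \<in> lipschitz_add (bump k b w) ` A w" by blast
  qed
  have "prob D = prob (\<Union>w\<in>T. A w)"
  proof -
    have "A w \<subseteq> D" for w by (auto simp: A_def)
    then have "D = (\<Union>w\<in>T. A w)" using ex1 by blast
    then show ?thesis by simp
  qed
  also have "\<dots> = (\<Sum>w\<in>T. prob (A w))"
  proof (rule finite_measure_finite_Union)
    show "disjoint_family_on A T"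
      using ex1 unfolding disjoint_family_on_def A_def by blast
  qed (use fin_T A_sets in auto)
  also have "\<dots> = (\<Sum>w\<in>T. prob G)"
  proof (rule sum.cong)
    fix w assume w: "w \<in> T"
    have "bump k b w \<in> lipschitz_funs val"
      using bump_local_perturbation[OF T_int[OF w]] by (auto simp: local_perturbations_def)
    then show "prob (A w) = prob G" using prob_translate[OF _ A_sets] transl[OF w] by metis
  qed simp
  finally have "prob D = real (q ^ (CARD('d) - 1)) * prob G" by (simp add: card_T)
  then show ?thesis using q_ge_2 by (simp add: G_def)
qed

text \<open>Either the child b is not kept, or it is kept with probability 1/m and its subtree dies
  out with probability \<beta>. The last probability enters as a hypothesis over all admissible
  events, so that the induction over generations can supply it.\<close>

lemma prob_child_extinct:
  assumes b: "b \<in> proj_space" and D: "stable D (Suc k) b k"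
    and good: "\<And>f. f \<in> D \<Longrightarrow> good k f b" and n: "Suc k \<le> n"
    and IH: "\<And>D. stable D (Suc k) b (Suc k) \<Longrightarrow> (\<And>f. f \<in> D \<Longrightarrow> good (Suc k) f b) \<Longrightarrow>
      prob {f \<in> D. \<not> hit n (Suc k) b f} = \<beta> * prob D"
  shows "prob {f \<in> D. \<not> hit n (Suc k) b f} = (1 - (1 - \<beta>) / real (q ^ (CARD('d) - 1))) * prob D"
proof -
  define G where "G = {f \<in> D. good (Suc k) f b}"
  have G_sets: "G \<in> sets P"
  proof -
    have "G = D \<inter> {f \<in> lipschitz_funs val. \<exists>t\<in>ideal_pow 0. t *s can val b + (f b + 0) \<in> vpow (Suc k)}"
      using stable_sub[OF D] by (auto simp: G_def good_def)
    moreover have "\<dots> \<in> sets P"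
      using D by (intro sets.Int sets_good b) (simp add: stable_def)
    ultimately show ?thesis by simp
  qed
  have D_sets: "D \<in> sets P" using D by (simp add: stable_def)
  \<comment> \<open>Goodness at level k+1 survives perturbations divisible by \<pi>^(k+1), so
    conditioning on it raises the size index of stability by one.\<close>
  have "lipschitz_add f h \<in> G" if "f \<in> G" and h: "h \<in> local_perturbations (Suc k) b (Suc k)" for f h
  proof -
    have "h \<in> local_perturbations (Suc k) b k"
      using h vpow_antimono[of k "Suc k"] by (auto simp: local_perturbations_def)
    moreover have "good (Suc k) (lipschitz_add f h) b"
    proof (rule good_perturb)
      show "good (Suc k) f b" using \<open>f \<in> G\<close> by (simp add: G_def)
      show "lipschitz_add f h b - f b \<in> vpow (Suc k)"
        using h b by (simp add: local_perturbations_def)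
    qed
    ultimately show ?thesis using that D by (simp add: G_def stable_def)
  qed
  then have "stable G (Suc k) b (Suc k)" using G_sets by (simp add: stable_def)
  then have prob_G: "prob {f \<in> G. \<not> hit n (Suc k) b f} = \<beta> * prob G"
    by (rule IH) (simp add: G_def)
  have meas: "{f \<in> G. \<not> hit n (Suc k) b f} \<in> sets P"
  proof -
    have "{f \<in> G. \<not> hit n (Suc k) b f} = G - {f \<in> lipschitz_funs val. hit n (Suc k) b f}"
      using stable_sub[OF D] by (auto simp: G_def)
    then show ?thesis using G_sets sets_hit by simp
  qed
  \<comment> \<open>A hit below b forces b itself to be kept, so outside G there is no hit.\<close>
  have "good (Suc k) f b" if "f \<in> D" "hit n (Suc k) b f" for f
    using that good_antimono[OF _ n] good_same_class[OF _ _ b] stable_sub[OF D]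
    unfolding hit_def by blast
  then have "{f \<in> D. \<not> hit n (Suc k) b f} = (D - G) \<union> {f \<in> G. \<not> hit n (Suc k) b f}"
    by (auto simp: G_def)
  also have "prob \<dots> = prob (D - G) + prob {f \<in> G. \<not> hit n (Suc k) b f}"
    using D_sets G_sets meas by (intro finite_measure_Union) auto
  also have "prob (D - G) = prob D - prob G"
    using D_sets G_sets by (intro finite_measure_Diff) (auto simp: G_def)
  also have "prob G = prob D / real (q ^ (CARD('d) - 1))"
    unfolding G_def using prob_good_child[OF b D good] .
  finally show ?thesis using prob_G \<open>prob G = _\<close> by (simp add: algebra_simps diff_divide_distrib)
qed

text \<open>Distinct classes are independent: a perturbation supported on one class does not affect
  whether another class is hit, so the classes can be conditioned upon one after the other.\<close>

lemma prob_children_extinct: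
  assumes "finite B" "B \<subseteq> proj_space"
    and "\<And>b c. b \<in> B \<Longrightarrow> c \<in> B \<Longrightarrow> same_class (Suc k) b c \<Longrightarrow> b = c"
    and "\<And>b. b \<in> B \<Longrightarrow> stable D (Suc k) b k"
    and "\<And>b f. b \<in> B \<Longrightarrow> f \<in> D \<Longrightarrow> good k f b" and n: "Suc k \<le> n"
    and "\<And>b D. b \<in> B \<Longrightarrow> stable D (Suc k) b (Suc k) \<Longrightarrow> (\<And>f. f \<in> D \<Longrightarrow> good (Suc k) f b) \<Longrightarrow>
      prob {f \<in> D. \<not> hit n (Suc k) b f} = \<beta> * prob D"
  shows "prob {f \<in> D. \<forall>b\<in>B. \<not> hit n (Suc k) b f}
    = (1 - (1 - \<beta>) / real (q ^ (CARD('d) - 1))) ^ card B * prob D"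
  using assms(1-5,7)
proof (induction B rule: finite_induct)
  case empty
  then show ?case by simp
next
  case (insert b B)
  define D' where "D' = {f \<in> D. \<forall>b\<in>B. \<not> hit n (Suc k) b f}"
  have D: "stable D (Suc k) b k" using insert.prems by simp
  have b: "b \<in> proj_space" using insert.prems by simp
  have "D' = D - (\<Union>b\<in>B. {f \<in> lipschitz_funs val. hit n (Suc k) b f})"
    using stable_sub[OF D] by (auto simp: D'_def)
  then have D'_sets: "D' \<in> sets P"
    using D sets_hit insert.hyps(1) by (auto simp: stable_def intro!: sets.Diff sets.finite_UN)
  have "hit n (Suc k) c f" if h: "h \<in> local_perturbations (Suc k) b k" and c: "c \<in> B"
    and hit: "hit n (Suc k) c (lipschitz_add f h)" for f h c
  proof -
    obtain a where a: "a \<in> proj_space" "same_class (Suc k) a c" "good n (lipschitz_add f h) a"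
      using hit by (auto simp: hit_def)
    have "\<not> same_class (Suc k) a b"
      using a c insert.hyps(2) insert.prems(2)[of c b] same_class_sym same_class_trans by blast
    then have "h a = 0" using h a by (auto simp: local_perturbations_def)
    then have "good n f a" using a by (simp add: good_def)
    then show ?thesis using a by (auto simp: hit_def)
  qed
  then have D': "stable D' (Suc k) b k"
    using D'_sets D by (auto simp: stable_def D'_def)
  have "{f \<in> D. \<forall>b\<in>insert b B. \<not> hit n (Suc k) b f} = {f \<in> D'. \<not> hit n (Suc k) b f}"
    by (auto simp: D'_def)
  also have "prob \<dots> = (1 - (1 - \<beta>) / real (q ^ (CARD('d) - 1))) * prob D'"
    by (rule prob_child_extinct[OF b D' _ n]) (use insert.prems in \<open>auto simp: D'_def\<close>)
  also have "prob D' = (1 - (1 - \<beta>) / real (q ^ (CARD('d) - 1))) ^ card B * prob D"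
    unfolding D'_def using insert.prems by (intro insert.IH) auto
  finally show ?case using insert.hyps by simp
qed

text \<open>Induction on the number j of remaining generations, with class, level and event all
  generalised: the children sit one level deeper and are conditioned on different events.\<close>

lemma prob_extinct:
  assumes "1 \<le> k" "b \<in> proj_space" "stable D k b k" "\<And>f. f \<in> D \<Longrightarrow> good k f b"
  shows "prob {f \<in> D. \<not> hit (k + j) k b f} = extinct (q ^ (CARD('d) - 1)) j * prob D"
  using assms
proof (induction j arbitrary: k b D)
  case 0
  \<comment> \<open>On D the line b is good at level k and is its own witness.\<close>
  then have "{f \<in> D. \<not> hit (k + 0) k b f} = {}"
    using same_class_refl unfolding hit_def by fastforce
  then show ?case by (metis extinct.simps(1) measure_empty mult_zero_left)
next
  case (Suc j)
  let ?n = "k + Suc j"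
  obtain B where B: "finite B" "card B = q ^ (CARD('d) - 1)" "B \<subseteq> proj_space"
    "\<And>c. c \<in> B \<Longrightarrow> same_class k c b"
    "\<And>a. a \<in> proj_space \<Longrightarrow> same_class k a b \<Longrightarrow> \<exists>!c. c \<in> B \<and> same_class (Suc k) a c"
    using class_children[OF Suc.prems(2,1)] by blast
  have anti: "same_class k a c" if "same_class (Suc k) a c" for a c :: "('a ^ 'd::{finite,linorder}) set"
    using that same_class_antimono[of "Suc k" a c k] by simp
  have "hit ?n k b f \<longleftrightarrow> (\<exists>c\<in>B. hit ?n (Suc k) c f)" for f
    using B(4,5) anti same_class_trans unfolding hit_def by metis
  then have "{f \<in> D. \<not> hit ?n k b f} = {f \<in> D. \<forall>c\<in>B. \<not> hit ?n (Suc k) c f}" by auto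
  also have "prob \<dots> = (1 - (1 - extinct (q ^ (CARD('d) - 1)) j) / real (q ^ (CARD('d) - 1))) ^ card B * prob D"
  proof (rule prob_children_extinct[OF B(1,3)])
    show "b1 = b2" if "b1 \<in> B" "b2 \<in> B" "same_class (Suc k) b1 b2" for b1 b2
      using B(3,4) B(5)[of b1] that same_class_refl by blast
    fix c assume c: "c \<in> B"
    \<comment> \<open>A perturbation supported on a child class is supported on the parent class, so
      stability is inherited.\<close>
    have "local_perturbations (Suc k) c k \<subseteq> local_perturbations k b k"
      using anti same_class_trans[OF _ B(4)[OF c]] unfolding local_perturbations_def by blast
    then show "stable D (Suc k) c k" using Suc.prems(3) by (auto simp: stable_def)
    show "good k f c" if "f \<in> D" for f
      using good_same_class[OF _ Suc.prems(2) _ same_class_sym[OF B(4)[OF c]]] c B(3)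
        Suc.prems(4)[OF that] that stable_sub[OF Suc.prems(3)] by blast
    fix D'
    assume "stable D' (Suc k) c (Suc k)" "\<And>f. f \<in> D' \<Longrightarrow> good (Suc k) f c"
    then show "prob {f \<in> D'. \<not> hit ?n (Suc k) c f} = extinct (q ^ (CARD('d) - 1)) j * prob D'"
      using Suc.IH[of "Suc k" c D'] c B(3) by auto
  qed simp
  finally show ?case by (simp add: B(2))
qed

text \<open>The number of points of the projective space over the residue field, written as a sum so
  that it can serve as an exponent.\<close>

definition root_degree :: nat where
  "root_degree = (\<Sum>i<CARD('d). q ^ i)"

lemma real_root_degree: "real root_degree = (real q ^ CARD('d) - 1) / (real q - 1)"
  using real_q_gt_1 by (simp add: root_degree_def geometric_sum)

text \<open>The root is treated separately because it has \<open>root_degree\<close> children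
  instead of m. Its children live at level 1, so level n+1 is n generations below them.\<close>

lemma prob_contains_0:
  "prob {f \<in> lipschitz_funs val. \<exists>a\<in>proj_space. good (Suc n) f a}
    = 1 - (1 - branch_survival (q ^ (CARD('d) - 1)) n) ^ root_degree"
proof -
  obtain B :: "('a ^ 'd::{finite,linorder}) set set" where B: "finite B"
    "real (card B) = (real q ^ CARD('d) - 1) / (real q - 1)" "B \<subseteq> proj_space"
    "\<And>a. a \<in> proj_space \<Longrightarrow> \<exists>!c. c \<in> B \<and> same_class 1 a c"
    using root_children by blast
  define E :: "('a, 'd::{finite,linorder}) line_map set"
    where "E = {f \<in> lipschitz_funs val. \<exists>a\<in>proj_space. good (Suc n) f a}"
  have card_B: "card B = root_degree" using B(2) real_root_degree by simp
  have "E \<in> sets P"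
    unfolding E_def by (rule sets_P_cylinder[where n = "Suc n"]) (use good_perturb in blast)+
  have "(\<exists>a\<in>proj_space. good (Suc n) f a) \<longleftrightarrow> (\<exists>c\<in>B. hit (Suc n) 1 c f)" for f
    using B(4) unfolding hit_def by blast
  then have "{f \<in> lipschitz_funs val. \<forall>c\<in>B. \<not> hit (Suc n) (Suc 0) c f} = space P - E"
    by (auto simp: E_def space_P One_nat_def)
  moreover have "prob {f \<in> lipschitz_funs val. \<forall>c\<in>B. \<not> hit (Suc n) (Suc 0) c f}
      = (1 - (1 - extinct (q ^ (CARD('d) - 1)) n) / real (q ^ (CARD('d) - 1))) ^ card B
        * prob (lipschitz_funs val)"
  proof (rule prob_children_extinct[OF B(1,3)])
    show "b1 = b2" if "b1 \<in> B" "b2 \<in> B" "same_class (Suc 0) b1 b2" for b1 b2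
      using B(3) B(4)[of b1] that same_class_refl unfolding One_nat_def by blast
    fix c assume c: "c \<in> B"
    \<comment> \<open>At level 0 nothing has been conditioned upon: the event is the whole group,
      and integrality makes every line good.\<close>
    show "stable (lipschitz_funs val) (Suc 0) c 0"
      using lipschitz_add_closed sets.top[of P]
      by (auto simp: stable_def space_P local_perturbations_def)
    show "good 0 f c" if "f \<in> lipschitz_funs val" for f
      using good_0 that c B(3) by blast
    fix D
    assume "stable D (Suc 0) c (Suc 0)" "\<And>f. f \<in> D \<Longrightarrow> good (Suc 0) f c"
    then show "prob {f \<in> D. \<not> hit (Suc n) (Suc 0) c f} = extinct (q ^ (CARD('d) - 1)) n * prob D"
      using prob_extinct[of "Suc 0" c D n] c B(3) by (auto simp: One_nat_def)
  qed simp
  ultimately show ?thesis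
    using prob_compl[OF \<open>E \<in> sets P\<close>] prob_space
    by (simp add: card_B branch_survival_def space_P E_def)
qed

end

section \<open>Expected measure of a neighbourhood\<close>

locale random_kakeya = random_lipschitz val P
  for val :: "'a::field \<Rightarrow> int"
    and P :: "('a, 'd::{finite,linorder}) line_map measure" +
  fixes \<mu> :: "('a ^ 'd::{finite,linorder}) measure"
  assumes haar_\<mu>: "haar_measure (vec_topology val) (+) \<mu>"
    and \<mu>_integral: "emeasure \<mu> (integral_vecs val) = 1"
begin

interpretation prob_space P by (rule prob_P)

definition meets :: "nat \<Rightarrow> 'a ^ 'd::{finite,linorder} \<Rightarrow>
    ('a, 'd::{finite,linorder}) line_map \<Rightarrow> bool" where
  "meets n x f \<longleftrightarrow> (\<exists>a\<in>proj_space. \<exists>t\<in>ideal_pow 0. t *s can val a + (f a - x) \<in> vpow n)"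

lemma meets_iff: "meets n x f \<longleftrightarrow> (\<exists>y\<in>kakeya_set val f. x - y \<in> vpow n)"
proof -
  have "x - (t *s can val a + f a) \<in> vpow n \<longleftrightarrow> t *s can val a + (f a - x) \<in> vpow n" for t a
    by (subst vpow_diff_commute) (simp add: add_diff_eq)
  then show ?thesis unfolding meets_def kakeya_set_def valuation_ring_eq by blast
qed

lemma sets_meets: "{f \<in> lipschitz_funs val. meets n x f} \<in> sets P"
proof (rule sets_P_cylinder[where n = n])
  fix f g :: "('a, 'd::{finite,linorder}) line_map"
  assume f: "f \<in> {f \<in> lipschitz_funs val. meets n x f}"
    and g: "g \<in> lipschitz_funs val" "\<And>a. a \<in> proj_space \<Longrightarrow> g a - f a \<in> vpow n"
  obtain a t where t: "a \<in> proj_space" "t \<in> ideal_pow 0" "t *s can val a + (f a - x) \<in> vpow n"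
    using f by (auto simp: meets_def)
  have "t *s can val a + (g a - x) = (t *s can val a + (f a - x)) + (g a - f a)" by simp
  then have "t *s can val a + (g a - x) \<in> vpow n" using t g(2) vpow_add by metis
  then show "g \<in> {f \<in> lipschitz_funs val. meets n x f}" using t g(1) by (auto simp: meets_def)
qed auto

lemma prob_meets:
  assumes x: "x \<in> vpow 0"
  shows "prob {f \<in> lipschitz_funs val. meets n x f} = prob {f \<in> lipschitz_funs val. meets n 0 f}"
proof -
  \<comment> \<open>Integral constants belong to the group of functions, so the invariance of
    \<open>P\<close> applies to them.\<close>
  have const: "(\<lambda>a\<in>proj_space. y) \<in> lipschitz_funs val" if "y \<in> vpow 0" for y :: "'a ^ 'd::{finite,linorder}"
    using that by (intro lipschitz_funsI) auto
  have "lipschitz_add (\<lambda>a\<in>proj_space. x) ` {f \<in> lipschitz_funs val. meets n 0 f}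
      = {f \<in> lipschitz_funs val. meets n x f}"
  proof (intro equalityI subsetI)
    fix g assume "g \<in> lipschitz_add (\<lambda>a\<in>proj_space. x) ` {f \<in> lipschitz_funs val. meets n 0 f}"
    then obtain f where f: "f \<in> lipschitz_funs val" "meets n 0 f"
      "g = lipschitz_add (\<lambda>a\<in>proj_space. x) f" by auto
    then show "g \<in> {f \<in> lipschitz_funs val. meets n x f}"
      using lipschitz_add_closed[OF const[OF x] f(1)] by (auto simp: meets_def)
  next
    fix g assume g: "g \<in> {f \<in> lipschitz_funs val. meets n x f}"
    define f where "f = lipschitz_add (\<lambda>a\<in>proj_space. - x) g"
    have "f \<in> lipschitz_funs val"
      unfolding f_def using x g by (intro lipschitz_add_closed const) auto
    moreover have "meets n 0 f" using g by (auto simp: meets_def f_def)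
    moreover have "g = lipschitz_add (\<lambda>a\<in>proj_space. x) f"
    proof (rule extensionalityI[of _ proj_space])
      show "g \<in> extensional proj_space" using g lipschitz_funsD(1) by auto
    qed (auto simp: f_def lipschitz_add_def)
    ultimately show "g \<in> lipschitz_add (\<lambda>a\<in>proj_space. x) ` {f \<in> lipschitz_funs val. meets n 0 f}"
      by blast
  qed
  then show ?thesis using prob_translate[OF const[OF x] sets_meets, of n 0] by simp
qed

text \<open>At this scale the neighbourhood is a union of cosets of \<pi>^(n+1) R^d inside R^d. Its
  measure is a finite sum of indicators of events, so linearity of the expectation exchanges the two
  integrals, and all summands are equal by \<open>prob_meets\<close>.\<close>

lemma expectation_neighbourhood:
  assumes \<epsilon>: "real q powi (- int (Suc n)) \<le> \<epsilon>" "\<epsilon> < real q powi (- int n)"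
  shows "(\<integral>f. measure \<mu> (neighbourhood val \<epsilon> (kakeya_set val f)) \<partial>P)
    = 1 - (1 - branch_survival (q ^ (CARD('d) - 1)) n) ^ root_degree"
proof -
  let ?N = "Suc n"
  let ?V = "vpow ?N :: ('a ^ 'd::{finite,linorder}) set"
  obtain X :: "('a ^ 'd::{finite,linorder}) set" where X: "finite X" "X \<subseteq> vpow 0"
    "\<And>z. z \<in> vpow 0 \<Longrightarrow> \<exists>!x. x \<in> X \<and> z - x \<in> ?V"
    using vec_residue_system by metis
  have coset: "(+) x ` ?V = {z. z - x \<in> ?V}" for x
    by (auto intro: image_eqI[of _ _ "z - x" for z])
  have coset_sets: "(+) x ` ?V \<in> sets \<mu>" for x
    using haar_\<mu> openin_coset by (auto simp: haar_measure_def)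
  have V_sets: "?V \<in> sets \<mu>" using coset_sets[of 0] by simp
  have em: "emeasure \<mu> ((+) x ` ?V) = emeasure \<mu> ?V" for x
    using haar_\<mu> V_sets by (simp add: haar_measure_def topspace_vec_topology)
  \<comment> \<open>Additivity of the real-valued \<open>measure\<close> requires finite values; the
    bound comes from the normalisation on R^d.\<close>
  have fin: "emeasure \<mu> ?V \<noteq> \<infinity>"
  proof -
    have "vpow 0 \<in> sets \<mu>"
      using haar_\<mu> openin_coset[of 0 0] by (auto simp: haar_measure_def)
    then have "emeasure \<mu> ?V \<le> emeasure \<mu> (vpow 0)"
      using vpow_antimono[of 0 ?N] by (intro emeasure_mono) auto
    then show ?thesis using \<mu>_integral by (auto simp: integral_vecs_eq top_unique)
  qed
  have disj: "disjoint_family_on (\<lambda>x. (+) x ` ?V) X"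
    unfolding disjoint_family_on_def
  proof (intro ballI impI)
    fix x y assume xy: "x \<in> X" "y \<in> X" "x \<noteq> y"
    show "(+) x ` ?V \<inter> (+) y ` ?V = {}"
    proof (rule ccontr)
      assume "(+) x ` ?V \<inter> (+) y ` ?V \<noteq> {}"
      then obtain z where "z - x \<in> ?V" "z - y \<in> ?V" unfolding coset by auto
      then have "x - y \<in> ?V" using vpow_diff_trans vpow_diff_commute by blast
      moreover have "x - x \<in> ?V" "x \<in> vpow 0" using xy X(2) by auto
      ultimately show False using X(3)[of x] xy by blast
    qed
  qed
  have union: "measure \<mu> (\<Union>x\<in>Y. (+) x ` ?V) = real (card Y) * measure \<mu> ?V" if "Y \<subseteq> X" for Y
  proof -
    have "measure \<mu> (\<Union>x\<in>Y. (+) x ` ?V) = (\<Sum>x\<in>Y. measure \<mu> ((+) x ` ?V))"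
      using that finite_subset[OF that X(1)] coset_sets em fin
        disjoint_family_on_mono[OF that disj]
      by (intro measure_finite_Union) auto
    then show ?thesis using em by (simp add: measure_def)
  qed
  have "vpow 0 = (\<Union>x\<in>X. (+) x ` ?V)"
  proof (intro equalityI subsetI)
    fix z :: "'a ^ 'd::{finite,linorder}" assume "z \<in> vpow 0"
    then show "z \<in> (\<Union>x\<in>X. (+) x ` ?V)" using X(3)[of z] unfolding coset by blast
  next
    fix z assume "z \<in> (\<Union>x\<in>X. (+) x ` ?V)"
    then obtain x v where "x \<in> X" "v \<in> ?V" "z = x + v" by auto
    then show "z \<in> vpow 0" using X(2) vpow_integral by (auto intro: vpow_add)
  qed
  \<comment> \<open>The normalisation makes the coset measure the reciprocal of the number of
    cosets, so averaging over cosets has total weight 1.\<close>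
  then have total: "real (card X) * measure \<mu> ?V = 1"
    using union[of X] \<mu>_integral by (simp add: integral_vecs_eq measure_def)
  have nbhd: "measure \<mu> (neighbourhood val \<epsilon> (kakeya_set val f))
      = (\<Sum>x\<in>X. measure \<mu> ?V * indicat_real {f \<in> lipschitz_funs val. meets ?N x f} f)"
    if f: "f \<in> space P" for f
  proof -
    have meets_cong: "meets ?N x f \<longleftrightarrow> meets ?N z f" if "z - x \<in> ?V" for x z
      using that vpow_diff_trans vpow_diff_commute unfolding meets_iff by metis
    \<comment> \<open>The Kakeya set lies in R^d and the scale is below 1, so the neighbourhood does
      not leave R^d and \<open>X\<close> covers it.\<close>
    have "z \<in> vpow 0" if "meets ?N z f" for z
    proof -
      obtain a t where "a \<in> proj_space" "t \<in> ideal_pow 0" "t *s can val a + (f a - z) \<in> ?V"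
        using \<open>meets ?N z f\<close> by (auto simp: meets_def)
      moreover have "z = (t *s can val a + f a) - (t *s can val a + (f a - z))" by simp
      moreover have "t *s can val a + f a \<in> vpow 0"
        using calculation(1,2) f lipschitz_funsD(2)
        by (intro vpow_add vpow_scale_left) (auto simp: space_P)
      ultimately show ?thesis using vpow_integral vpow_diff by metis
    qed
    then have cosets: "{z. meets ?N z f} = (\<Union>x\<in>{x \<in> X. meets ?N x f}. (+) x ` ?V)"
      unfolding coset using X(3) meets_cong by blast
    have "neighbourhood val \<epsilon> (kakeya_set val f) = {z. meets ?N z f}"
      using neighbourhood_eq[OF kakeya_set_nonempty \<epsilon>] by (simp add: meets_iff)
    then have "measure \<mu> (neighbourhood val \<epsilon> (kakeya_set val f))
        = real (card {x \<in> X. meets ?N x f}) * measure \<mu> ?V"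
      by (simp only: cosets) (rule union, blast)
    also have "real (card {x \<in> X. meets ?N x f})
        = (\<Sum>x\<in>X. indicat_real {f \<in> lipschitz_funs val. meets ?N x f} f)"
      using X(1) f by (simp add: indicator_def space_P sum.If_cases Int_def)
    finally show ?thesis by (simp add: sum_distrib_left mult.commute)
  qed
  have "(\<integral>f. measure \<mu> (neighbourhood val \<epsilon> (kakeya_set val f)) \<partial>P)
      = (\<integral>f. (\<Sum>x\<in>X. measure \<mu> ?V * indicat_real {f \<in> lipschitz_funs val. meets ?N x f} f) \<partial>P)"
    by (rule Bochner_Integration.integral_cong[OF refl nbhd])
  also have "\<dots> = (\<Sum>x\<in>X. measure \<mu> ?V * prob {f \<in> lipschitz_funs val. meets ?N x f})"
    using sets_meets
    by (subst Bochner_Integration.integral_sum)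
      (auto simp: emeasure_eq_measure space_P intro!: sum.cong arg_cong[of _ _ prob])
  also have "\<dots> = (\<Sum>x\<in>X. measure \<mu> ?V * prob {f \<in> lipschitz_funs val. meets ?N 0 f})"
  proof (rule sum.cong[OF refl])
    fix x assume "x \<in> X"
    then have "x \<in> vpow 0" using X(2) by blast
    from prob_meets[OF this, of ?N]
    show "measure \<mu> ?V * prob {f \<in> lipschitz_funs val. meets ?N x f}
        = measure \<mu> ?V * prob {f \<in> lipschitz_funs val. meets ?N 0 f}" by (rule arg_cong)
  qed
  also have "\<dots> = prob {f \<in> lipschitz_funs val. meets ?N 0 f}"
    by (simp only: sum_constant mult.assoc[symmetric] total mult_1)
  also have "{f \<in> lipschitz_funs val. meets ?N 0 f}
      = {f \<in> lipschitz_funs val. \<exists>a\<in>proj_space. good ?N f a}"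
    by (simp add: meets_def good_def)
  finally show ?thesis using prob_contains_0 by simp
qed

end

section \<open>From powers of the uniformizer to all small radii\<close>

theorem theorem2:
  fixes val :: "'a::field \<Rightarrow> int"
    and \<mu> :: "('a ^ 'd::{finite,linorder}) measure"
    and P :: "(('a ^ 'd::{finite,linorder}) set \<Rightarrow> 'a ^ 'd::{finite,linorder}) measure"
    and q :: nat
  assumes "nonarch_local_field val"
    and "q = card (residue_field val)"
    and "CARD('d) \<ge> 2"
    and "haar_measure (vec_topology val) (+) \<mu>"
    and "emeasure \<mu> (integral_vecs val) = 1"
    and "haar_measure (lipschitz_topology val) lipschitz_add P"
    and "prob_space P"
  shows "(\<lambda>\<epsilon>. \<integral>f. measure \<mu> (neighbourhood val \<epsilon> (kakeya_set val f)) \<partial>P)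
           \<sim>[at_right 0]
         (\<lambda>\<epsilon>. 2 * (real q ^ CARD('d) - 1) / ((real q - 1) * (real q ^ (CARD('d) - 1) - 1))
              * (1 / \<bar>log (real q) \<epsilon>\<bar>))"
proof -
  interpret nonarch_local_field val by fact
  interpret random_kakeya val P \<mu>
    using assms(4-7)
    by (intro random_kakeya.intro random_lipschitz.intro random_lipschitz_axioms.intro
        random_kakeya_axioms.intro nonarch_local_field_axioms)
  define m where "m = q ^ (CARD('d) - 1)"
  define c where "c = 2 * (real q ^ CARD('d) - 1) / ((real q - 1) * (real q ^ (CARD('d) - 1) - 1))"
  define p where "p n = 1 - (1 - branch_survival m n) ^ root_degree" for n
  \<comment> \<open>For \<epsilon> < 1 this is the n with q^(-n-1) \<le> \<epsilon> < q^(-n). The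
    ceiling minus one, rather than the floor, puts the endpoint \<epsilon> = q^(-n-1) into the right
    interval.\<close>
  define N where "N \<epsilon> = nat (\<lceil>- log (real q) \<epsilon>\<rceil> - 1)" for \<epsilon>
  have q: "2 \<le> q" using q_ge_2 assms(2) by simp
  then have q1: "1 < real q" by simp
  \<comment> \<open>Here d \<ge> 2 enters: the tree must really branch.\<close>
  have "q ^ 1 \<le> m" unfolding m_def using q assms(3) by (intro power_increasing) auto
  then have m: "2 \<le> m" using q by simp
  have "real q ^ CARD('d) > 1" using q1 by (intro one_less_power) auto
  moreover have "real q ^ (CARD('d) - 1) > 1" using q1 assms(3) by (intro one_less_power) auto
  ultimately have c: "c > 0" using q1 by (simp add: c_def)
  have "(\<lambda>n. real (Suc n) * p n) \<longlonglongrightarrow> 2 * real root_degree / (real m - 1)"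
    unfolding p_def by (rule forest_survival_asymp[OF m])
  \<comment> \<open>The factor 2/(m-1) with m = q^(d-1), multiplied by the number (q^d-1)/(q-1) of
    branches at the root.\<close>
  moreover have "2 * real root_degree / (real m - 1) = c"
    using assms(2) by (simp add: c_def m_def real_root_degree)
  ultimately have lim: "(\<lambda>n. real (Suc n) * p n) \<longlonglongrightarrow> c" by simp
  have log_lim: "filterlim (\<lambda>\<epsilon>. - log (real q) \<epsilon>) at_top (at_right 0)"
    using q1 by real_asymp
  have N_bounds: "- log (real q) \<epsilon> \<le> real (Suc (N \<epsilon>)) \<and> real (N \<epsilon>) < - log (real q) \<epsilon>"
    if "0 < - log (real q) \<epsilon>" for \<epsilon>
  proof -
    have "1 \<le> \<lceil>- log (real q) \<epsilon>\<rceil>" using that by simp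
    then have "real (N \<epsilon>) = of_int \<lceil>- log (real q) \<epsilon>\<rceil> - 1" by (simp add: N_def)
    then show ?thesis by linarith
  qed
  have ev: "eventually (\<lambda>\<epsilon>. 0 < - log (real q) \<epsilon>) (at_right 0)"
    using log_lim unfolding filterlim_at_top_dense by blast
  have N_lim: "filterlim N at_top (at_right 0)"
    unfolding filterlim_sequentially_iff_filterlim_real
  proof (rule filterlim_at_top_mono)
    show "filterlim (\<lambda>\<epsilon>. - log (real q) \<epsilon> - 1) at_top (at_right 0)"
      using q1 by real_asymp
    show "eventually (\<lambda>\<epsilon>. - log (real q) \<epsilon> - 1 \<le> real (N \<epsilon>)) (at_right 0)"
      using ev
    proof eventually_elim
      case (elim \<epsilon>)
      then show ?case using N_bounds[OF elim] by linarith
    qed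
  qed
  \<comment> \<open>The logarithm lies between N and N+1 in absolute value, so replacing N+1 by it
    does not change the limit.\<close>
  have ratio: "((\<lambda>\<epsilon>. \<bar>log (real q) \<epsilon>\<bar> / real (Suc (N \<epsilon>))) \<longlongrightarrow> 1) (at_right 0)"
  proof (rule tendsto_sandwich)
    show "eventually (\<lambda>\<epsilon>. 1 - 1 / real (Suc (N \<epsilon>)) \<le> \<bar>log (real q) \<epsilon>\<bar> / real (Suc (N \<epsilon>))) (at_right 0)"
      using ev
    proof eventually_elim
      case (elim \<epsilon>)
      have "1 - 1 / real (Suc (N \<epsilon>)) = real (N \<epsilon>) / real (Suc (N \<epsilon>))"
        by (simp add: field_simps)
      also have "\<dots> \<le> \<bar>log (real q) \<epsilon>\<bar> / real (Suc (N \<epsilon>))"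
        using elim N_bounds[OF elim] by (intro divide_right_mono) auto
      finally show ?case .
    qed
    show "eventually (\<lambda>\<epsilon>. \<bar>log (real q) \<epsilon>\<bar> / real (Suc (N \<epsilon>)) \<le> 1) (at_right 0)"
      using ev
    proof eventually_elim
      case (elim \<epsilon>)
      then show ?case using N_bounds[OF elim] by (simp add: field_simps)
    qed
    have "(\<lambda>n. 1 - 1 / real (Suc n)) \<longlonglongrightarrow> 1" by real_asymp
    then show "((\<lambda>\<epsilon>. 1 - 1 / real (Suc (N \<epsilon>))) \<longlongrightarrow> 1) (at_right 0)"
      by (rule filterlim_compose[OF _ N_lim])
  qed simp
  have "((\<lambda>\<epsilon>. real (Suc (N \<epsilon>)) * p (N \<epsilon>) * (\<bar>log (real q) \<epsilon>\<bar> / real (Suc (N \<epsilon>)))) \<longlongrightarrow> c * 1) (at_right 0)"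
    by (intro tendsto_mult ratio filterlim_compose[OF lim N_lim])
  then have main: "((\<lambda>\<epsilon>. p (N \<epsilon>) * \<bar>log (real q) \<epsilon>\<bar> / c) \<longlongrightarrow> 1) (at_right 0)"
    using c tendsto_divide[OF _ tendsto_const[of c]] by (fastforce simp del: of_nat_Suc)
  have expect: "eventually (\<lambda>\<epsilon>. p (N \<epsilon>) = (\<integral>f. measure \<mu> (neighbourhood val \<epsilon> (kakeya_set val f)) \<partial>P))
      (at_right 0)"
    using ev eventually_at_right_less[of 0]
  proof eventually_elim
    case (elim \<epsilon>)
    have powi: "real q powi (- int k) = real q powr (- real k)" for k
      using q1 by (simp add: powr_minus powr_realpow power_int_minus)
    have "\<epsilon> = real q powr log (real q) \<epsilon>" using elim q1 by simp
    moreover have "real q powr (- real (Suc (N \<epsilon>))) \<le> real q powr log (real q) \<epsilon>"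
      using N_bounds[OF elim(1)] q1 by (intro powr_mono) auto
    moreover have "real q powr log (real q) \<epsilon> < real q powr (- real (N \<epsilon>))"
      using N_bounds[OF elim(1)] q1 by (intro powr_less_mono) auto
    ultimately have "real q powi (- int (Suc (N \<epsilon>))) \<le> \<epsilon>" "\<epsilon> < real q powi (- int (N \<epsilon>))"
      unfolding powi by metis+
    then show ?case
      using expectation_neighbourhood[of "N \<epsilon>" \<epsilon>] assms(2) by (simp add: p_def m_def)
  qed
  show ?thesis
    unfolding c_def[symmetric]
  proof (rule asymp_equivI')
    show "((\<lambda>\<epsilon>. (\<integral>f. measure \<mu> (neighbourhood val \<epsilon> (kakeya_set val f)) \<partial>P) / (c * (1 / \<bar>log (real q) \<epsilon>\<bar>)))
        \<longlongrightarrow> 1) (at_right 0)"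
      using main
    proof (rule Lim_transform_eventually)
      show "eventually (\<lambda>\<epsilon>. p (N \<epsilon>) * \<bar>log (real q) \<epsilon>\<bar> / c =
          (\<integral>f. measure \<mu> (neighbourhood val \<epsilon> (kakeya_set val f)) \<partial>P) / (c * (1 / \<bar>log (real q) \<epsilon>\<bar>))) (at_right 0)"
        using expect ev by eventually_elim simp
    qed
  qed
qed

end
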